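(* Let $(M,I,J,K,g_M)$ be a hyperkähler manifold, $(N,g_N)$ a Riemannian manifold, and $F:(M,g_M)\to(N,g_N)$ a h-anti-invariant submersion such that $(I,J,K)$ is a h-anti-invariant basis, i.e. $F$ is a Riemannian submersion with $R(\ker F_* )\subset(\ker F_* )^{\perp}$ for each $R\in\{I,J,K\}$. Then the following conditions are equivalent: a) $F$ is a totally geodesic map; b) $\mathcal{A}_X IV=0$, $Q_I\mathcal{H}\nabla_X IV=0$, $\mathcal{T}_V IW=0$, and $Q_I\mathcal{H}\nabla_V IW=0$ for all $V,W\in\Gamma(\ker F_* )$ and $X\in\Gamma((\ker F_* )^{\perp})$; c) $\mathcal{A}_X JV=0$, $Q_J\mathcal{H}\nabla_X JV=0$, $\mathcal{T}_V JW=0$, and $Q_J\mathcal{H}\nabla_V JW=0$ for all $V,W\in\Gamma(\ker F_* )$ and $X\in\Gamma((\ker F_* )^{\perp})$; d) $\mathcal{A}_X KV=0$, $Q_K\mathcal{H}\nabla_X KV=0$, $\mathcal{T}_V KW=0$, and $Q_K\mathcal{H}\nabla_V KW=0$ for all $V,W\in\Gamma(\ker F_* )$ and $X\in\Gamma((\ker F_* )^{\perp})$.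
   Context: A hyperkähler manifold $(M,I,J,K,g_M)$ is a $4m$-dimensional Riemannian manifold with endomorphism fields $I,J,K$ of $TM$ satisfying $I^2=J^2=K^2=-\mathrm{id}$, $IJ=-JI=K$, $JK=-KJ=I$, $KI=-IK=J$, $g_M(RX,RY)=g_M(X,Y)$ for $R\in\{I,J,K\}$, and $\nabla I=\nabla J=\nabla K=0$, where $\nabla$ is the Levi-Civita connection of $g_M$. A Riemannian submersion $F:(M,g_M)\to(N,g_N)$ is a smooth surjective submersion such that $(F_* )_p:(\ker (F_* )_p)^{\perp}\to T_{F(p)}N$ is a linear isometry for every $p\in M$. For a vector field $U$ on $M$ write $U=\mathcal{V}U+\mathcal{H}U$ with $\mathcal{V}U\in\Gamma(\ker F_* )$ and $\mathcal{H}U\in\Gamma((\ker F_* )^{\perp})$. The O'Neill tensors are $$\mathcal{A}_U W=\mathcal{H}\nabla_{\mathcal{H}U}\mathcal{V}W+\mathcal{V}\nabla_{\mathcal{H}U}\mathcal{H}W,\qquad \mathcal{T}_U W=\mathcal{H}\nabla_{\mathcal{V}U}\mathcal{V}W+\mathcal{V}\nabla_{\mathcal{V}U}\mathcal{H}W .$$ For $R\in\{I,J,K\}$ let $\mu_R$ be the orthogonal complement of $R(\ker F_* )$ in $(\ker F_* )^{\perp}$, so $(\ker F_* )^{\perp}=R(\ker F_* )\oplus\mu_R$, and let $Q_R:(\ker F_* )^{\perp}\to\mu_R$ be the orthogonal projection. The second fundamental form of $F$ is $(\nabla F_* )(U,W)=\nabla^F_U F_*W-F_*(\nabla_UW)$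 for $U,W\in\Gamma(TM)$, where $\nabla^F$ is the pullback connection along $F$; $F$ is a totally geodesic map if $\nabla F_*=0$. *)

theory Defs
  imports "HOL-Analysis.Analysis"
begin

section \<open>Smooth maps between Euclidean spaces\<close>

text \<open>The predicates below are meant for open sets \<open>S\<close>; they only depend on the values of
  \<open>f\<close> on \<open>S\<close>. Iterating over all directions \<open>v\<close> gives all partial derivatives of order at
  most \<open>k\<close>.\<close>

primrec Ck_on :: "nat \<Rightarrow> 'e::euclidean_space set \<Rightarrow> ('e \<Rightarrow> 'f::euclidean_space) \<Rightarrow> bool" where
  "Ck_on 0 S f \<longleftrightarrow> continuous_on S f"
| "Ck_on (Suc k) S f \<longleftrightarrow>
     f differentiable_on S \<and> (\<forall>v. Ck_on k S (\<lambda>x. frechet_derivative f (at x) v))"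

definition smooth_on :: "'e::euclidean_space set \<Rightarrow> ('e \<Rightarrow> 'f::euclidean_space) \<Rightarrow> bool" where
  "smooth_on S f \<longleftrightarrow> (\<forall>k. Ck_on k S f)"


section \<open>Smooth manifolds\<close>

text \<open>The points of a manifold form a whole (Hausdorff, second countable) type \<open>'a\<close>, and the model
  space is a Euclidean space \<open>'e\<close>, so that the dimension is \<open>DIM('e)\<close>. A chart is a pair of its
  domain and its coordinate map. The smooth structure is given by an atlas, which need not be
  maximal.\<close>

type_synonym ('a, 'e) chart = "'a set \<times> ('a \<Rightarrow> 'e)"

definition chart_inv :: "('a, 'e) chart \<Rightarrow> 'e \<Rightarrow> 'a" where
  "chart_inv c = inv_into (fst c) (snd c)"

definition is_chart :: "('a::topological_space, 'e::euclidean_space) chart \<Rightarrow> bool" where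
  "is_chart c \<longleftrightarrow> open (fst c) \<and> open (snd c ` fst c) \<and>
     homeomorphism (fst c) (snd c ` fst c) (snd c) (chart_inv c)"

definition smooth_manifold ::
  "('a::{t2_space, second_countable_topology}, 'e::euclidean_space) chart set \<Rightarrow> bool" where
  "smooth_manifold A \<longleftrightarrow>
     (\<forall>c\<in>A. is_chart c) \<and> (\<Union>c\<in>A. fst c) = UNIV \<and>
     (\<forall>c\<in>A. \<forall>d\<in>A. smooth_on (snd c ` (fst c \<inter> fst d)) (snd d \<circ> chart_inv c))"

text \<open>At every point \<open>p\<close> one chart of the atlas is singled out, and the tangent space \<open>T\<^sub>p M\<close> is
  identified with the model space \<open>'e\<close> through the coordinate frame of that chart. Hence a vector
  field is a function \<open>'a \<Rightarrow> 'e\<close>, an endomorphism field is a function \<open>'a \<Rightarrow> 'e \<Rightarrow> 'e\<close>, and a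
  metric is a function \<open>'a \<Rightarrow> 'e \<Rightarrow> 'e \<Rightarrow> real\<close>. Since the chosen chart jumps from point to point,
  smoothness of such objects is never smoothness of these functions as they stand: components
  have to be transported to a fixed chart first, see \<open>in_chart\<close>.\<close>

definition chart_at :: "('a, 'e) chart set \<Rightarrow> 'a \<Rightarrow> ('a, 'e) chart" where
  "chart_at A p = (SOME c. c \<in> A \<and> p \<in> fst c)"

definition in_chart ::
  "('a, 'e::euclidean_space) chart set \<Rightarrow> ('a, 'e) chart \<Rightarrow> 'a \<Rightarrow> 'e \<Rightarrow> 'e" where
  "in_chart A d p v =
     frechet_derivative (snd d \<circ> chart_inv (chart_at A p)) (at (snd (chart_at A p) p)) v"

definition smooth_functions :: "('a, 'e::euclidean_space) chart set \<Rightarrow> ('a \<Rightarrow> real) set" where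
  "smooth_functions A = {f. \<forall>c\<in>A. smooth_on (snd c ` fst c) (f \<circ> chart_inv c)}"

text \<open>The derivative \<open>v f\<close> of the function \<open>f\<close> in the direction of \<open>v \<in> T\<^sub>p M\<close>.\<close>

definition dir_deriv ::
  "('a, 'e::euclidean_space) chart set \<Rightarrow> ('a \<Rightarrow> real) \<Rightarrow> 'a \<Rightarrow> 'e \<Rightarrow> real" where
  "dir_deriv A f p v =
     frechet_derivative (f \<circ> chart_inv (chart_at A p)) (at (snd (chart_at A p) p)) v"

definition smooth_map ::
  "('a::topological_space, 'e::euclidean_space) chart set \<Rightarrow>
   ('b::topological_space, 'f::euclidean_space) chart set \<Rightarrow> ('a \<Rightarrow> 'b) \<Rightarrow> bool" where
  "smooth_map A B F \<longleftrightarrow> continuous_on UNIV F \<and>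
     (\<forall>c\<in>A. \<forall>d\<in>B. smooth_on (snd c ` (fst c \<inter> F -` fst d)) (snd d \<circ> F \<circ> chart_inv c))"

text \<open>The differential \<open>(F\<^sub>*)\<^sub>p : T\<^sub>p M \<rightarrow> T\<^bsub>F p\<^esub> N\<close>.\<close>

definition differential ::
  "('a, 'e::euclidean_space) chart set \<Rightarrow> ('b, 'f::euclidean_space) chart set \<Rightarrow>
   ('a \<Rightarrow> 'b) \<Rightarrow> 'a \<Rightarrow> 'e \<Rightarrow> 'f" where
  "differential A B F p v =
     frechet_derivative (snd (chart_at B (F p)) \<circ> F \<circ> chart_inv (chart_at A p))
       (at (snd (chart_at A p) p)) v"

text \<open>Smooth sections of the pullback bundle \<open>F\<^sup>* TN\<close>, that is, vector fields along \<open>F\<close>; vector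
  fields on \<open>M\<close> are the sections along the identity of \<open>M\<close>.\<close>

definition sections_along ::
  "('a, 'e::euclidean_space) chart set \<Rightarrow> ('b, 'f::euclidean_space) chart set \<Rightarrow>
   ('a \<Rightarrow> 'b) \<Rightarrow> ('a \<Rightarrow> 'f) set" where
  "sections_along A B F =
     {S. \<forall>c\<in>A. \<forall>d\<in>B. smooth_on (snd c ` (fst c \<inter> F -` fst d))
        ((\<lambda>p. in_chart B d (F p) (S p)) \<circ> chart_inv c)}"

definition vector_fields :: "('a, 'e::euclidean_space) chart set \<Rightarrow> ('a \<Rightarrow> 'e) set" where
  "vector_fields A = sections_along A A id"

definition endomorphism_field ::
  "('a, 'e::euclidean_space) chart set \<Rightarrow> ('a \<Rightarrow> 'e \<Rightarrow> 'e) \<Rightarrow> bool" where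
  "endomorphism_field A R \<longleftrightarrow>
     (\<forall>p. linear (R p)) \<and> (\<forall>X\<in>vector_fields A. (\<lambda>p. R p (X p)) \<in> vector_fields A)"


section \<open>Riemannian metrics and connections\<close>

definition riemannian_metric ::
  "('a, 'e::euclidean_space) chart set \<Rightarrow> ('a \<Rightarrow> 'e \<Rightarrow> 'e \<Rightarrow> real) \<Rightarrow> bool" where
  "riemannian_metric A g \<longleftrightarrow>
     (\<forall>p. bilinear (g p)) \<and>
     (\<forall>p v w. g p v w = g p w v) \<and>
     (\<forall>p v. v \<noteq> 0 \<longrightarrow> g p v v > 0) \<and>
     (\<forall>X\<in>vector_fields A. \<forall>Y\<in>vector_fields A. (\<lambda>p. g p (X p) (Y p)) \<in> smooth_functions A)"

definition riemannian_manifold ::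
  "('a::{t2_space, second_countable_topology}, 'e::euclidean_space) chart set \<Rightarrow>
   ('a \<Rightarrow> 'e \<Rightarrow> 'e \<Rightarrow> real) \<Rightarrow> bool" where
  "riemannian_manifold A g \<longleftrightarrow> smooth_manifold A \<and> riemannian_metric A g"

text \<open>A connection on the bundle \<open>F\<^sup>* TN\<close>: \<open>D p u S\<close> is the covariant derivative \<open>D\<^sub>u S\<close> at \<open>p\<close> of
  the section \<open>S\<close> in the direction of the single tangent vector \<open>u \<in> T\<^sub>p M\<close>. In terms of vector
  fields, \<open>(D\<^sub>U S)(p)\<close> is \<open>D p (U p) S\<close>. Values at non-smooth \<open>S\<close> are irrelevant.\<close>

definition connection_along ::
  "('a, 'e::euclidean_space) chart set \<Rightarrow> ('b, 'f::euclidean_space) chart set \<Rightarrow>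
   ('a \<Rightarrow> 'b) \<Rightarrow> ('a \<Rightarrow> 'e \<Rightarrow> ('a \<Rightarrow> 'f) \<Rightarrow> 'f) \<Rightarrow> bool" where
  "connection_along A B F D \<longleftrightarrow>
     (\<forall>p. \<forall>S\<in>sections_along A B F. linear (\<lambda>u. D p u S)) \<and>
     (\<forall>p u. \<forall>S\<in>sections_along A B F. \<forall>T\<in>sections_along A B F.
        D p u (\<lambda>q. S q + T q) = D p u S + D p u T) \<and>
     (\<forall>p u. \<forall>f\<in>smooth_functions A. \<forall>S\<in>sections_along A B F.
        D p u (\<lambda>q. f q *\<^sub>R S q) = dir_deriv A f p u *\<^sub>R S p + f p *\<^sub>R D p u S) \<and>
     (\<forall>U\<in>vector_fields A. \<forall>S\<in>sections_along A B F.
        (\<lambda>p. D p (U p) S) \<in> sections_along A B F)"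

definition is_lie_bracket ::
  "('a, 'e::euclidean_space) chart set \<Rightarrow> ('a \<Rightarrow> 'e) \<Rightarrow> ('a \<Rightarrow> 'e) \<Rightarrow> ('a \<Rightarrow> 'e) \<Rightarrow> bool" where
  "is_lie_bracket A X Y Z \<longleftrightarrow> Z \<in> vector_fields A \<and>
     (\<forall>f\<in>smooth_functions A. \<forall>p.
        dir_deriv A f p (Z p) =
          dir_deriv A (\<lambda>q. dir_deriv A f q (Y q)) p (X p)
        - dir_deriv A (\<lambda>q. dir_deriv A f q (X q)) p (Y p))"

definition levi_civita ::
  "('a, 'e::euclidean_space) chart set \<Rightarrow> ('a \<Rightarrow> 'e \<Rightarrow> 'e \<Rightarrow> real) \<Rightarrow>
   ('a \<Rightarrow> 'e \<Rightarrow> ('a \<Rightarrow> 'e) \<Rightarrow> 'e) \<Rightarrow> bool" where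
  "levi_civita A g nab \<longleftrightarrow>
     connection_along A A id nab \<and>
     (\<forall>p u. \<forall>X\<in>vector_fields A. \<forall>Y\<in>vector_fields A.
        dir_deriv A (\<lambda>q. g q (X q) (Y q)) p u = g p (nab p u X) (Y p) + g p (X p) (nab p u Y)) \<and>
     (\<forall>X\<in>vector_fields A. \<forall>Y\<in>vector_fields A.
        is_lie_bracket A X Y (\<lambda>p. nab p (X p) Y - nab p (Y p) X))"

text \<open>The pullback to \<open>F\<^sup>* TN\<close> of a connection \<open>nabN\<close> on \<open>N\<close>, characterised (uniquely, on smooth
  sections) by \<open>D\<^sub>u (Y \<circ> F) = nabN\<^bsub>F\<^sub>* u\<^esub> Y\<close>.\<close>

definition pullback_connection ::
  "('a, 'e::euclidean_space) chart set \<Rightarrow> ('b, 'f::euclidean_space) chart set \<Rightarrow>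
   ('a \<Rightarrow> 'b) \<Rightarrow> ('b \<Rightarrow> 'f \<Rightarrow> ('b \<Rightarrow> 'f) \<Rightarrow> 'f) \<Rightarrow> ('a \<Rightarrow> 'e \<Rightarrow> ('a \<Rightarrow> 'f) \<Rightarrow> 'f) \<Rightarrow> bool" where
  "pullback_connection A B F nabN D \<longleftrightarrow>
     connection_along A B F D \<and>
     (\<forall>p u. \<forall>Y\<in>vector_fields B. D p u (\<lambda>q. Y (F q)) = nabN (F p) (differential A B F p u) Y)"

definition second_fundamental_form ::
  "('a, 'e::euclidean_space) chart set \<Rightarrow> ('b, 'f::euclidean_space) chart set \<Rightarrow>
   ('a \<Rightarrow> 'b) \<Rightarrow> ('a \<Rightarrow> 'e \<Rightarrow> ('a \<Rightarrow> 'e) \<Rightarrow> 'e) \<Rightarrow> ('a \<Rightarrow> 'e \<Rightarrow> ('a \<Rightarrow> 'f) \<Rightarrow> 'f) \<Rightarrow>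
   ('a \<Rightarrow> 'e) \<Rightarrow> ('a \<Rightarrow> 'e) \<Rightarrow> 'a \<Rightarrow> 'f" where
  "second_fundamental_form A B F nabM nabF U W p =
     nabF p (U p) (\<lambda>q. differential A B F q (W q)) - differential A B F p (nabM p (U p) W)"

definition totally_geodesic_map ::
  "('a, 'e::euclidean_space) chart set \<Rightarrow> ('b, 'f::euclidean_space) chart set \<Rightarrow>
   ('a \<Rightarrow> 'b) \<Rightarrow> ('a \<Rightarrow> 'e \<Rightarrow> ('a \<Rightarrow> 'e) \<Rightarrow> 'e) \<Rightarrow> ('a \<Rightarrow> 'e \<Rightarrow> ('a \<Rightarrow> 'f) \<Rightarrow> 'f) \<Rightarrow> bool" where
  "totally_geodesic_map A B F nabM nabF \<longleftrightarrow>
     (\<forall>U\<in>vector_fields A. \<forall>W\<in>vector_fields A. \<forall>p.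
        second_fundamental_form A B F nabM nabF U W p = 0)"


section \<open>Hyperkaehler manifolds\<close>

definition hyperkaehler ::
  "('a::{t2_space, second_countable_topology}, 'e::euclidean_space) chart set \<Rightarrow>
   ('a \<Rightarrow> 'e \<Rightarrow> 'e) \<Rightarrow> ('a \<Rightarrow> 'e \<Rightarrow> 'e) \<Rightarrow> ('a \<Rightarrow> 'e \<Rightarrow> 'e) \<Rightarrow>
   ('a \<Rightarrow> 'e \<Rightarrow> 'e \<Rightarrow> real) \<Rightarrow> ('a \<Rightarrow> 'e \<Rightarrow> ('a \<Rightarrow> 'e) \<Rightarrow> 'e) \<Rightarrow> bool" where
  "hyperkaehler A I J K g nab \<longleftrightarrow>
     riemannian_manifold A g \<and> levi_civita A g nab \<and> (\<exists>m. DIM('e) = 4 * m) \<and>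
     (\<forall>R\<in>{I, J, K}. endomorphism_field A R) \<and>
     (\<forall>R\<in>{I, J, K}. \<forall>p v. R p (R p v) = - v) \<and>
     (\<forall>p v. I p (J p v) = K p v \<and> J p (I p v) = - K p v) \<and>
     (\<forall>p v. J p (K p v) = I p v \<and> K p (J p v) = - I p v) \<and>
     (\<forall>p v. K p (I p v) = J p v \<and> I p (K p v) = - J p v) \<and>
     (\<forall>R\<in>{I, J, K}. \<forall>p v w. g p (R p v) (R p w) = g p v w) \<and>
     (\<forall>R\<in>{I, J, K}. \<forall>p u. \<forall>X\<in>vector_fields A. nab p u (\<lambda>q. R q (X q)) = R p (nab p u X))"


section \<open>Riemannian submersions\<close>

definition vertical_space ::
  "('a, 'e::euclidean_space) chart set \<Rightarrow> ('b, 'f::euclidean_space) chart set \<Rightarrow>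
   ('a \<Rightarrow> 'b) \<Rightarrow> 'a \<Rightarrow> 'e set" where
  "vertical_space A B F p = {v. differential A B F p v = 0}"

definition horizontal_space ::
  "('a, 'e::euclidean_space) chart set \<Rightarrow> ('a \<Rightarrow> 'e \<Rightarrow> 'e \<Rightarrow> real) \<Rightarrow>
   ('b, 'f::euclidean_space) chart set \<Rightarrow> ('a \<Rightarrow> 'b) \<Rightarrow> 'a \<Rightarrow> 'e set" where
  "horizontal_space A g B F p = {w. \<forall>v\<in>vertical_space A B F p. g p w v = 0}"

definition riemannian_submersion ::
  "('a::topological_space, 'e::euclidean_space) chart set \<Rightarrow> ('a \<Rightarrow> 'e \<Rightarrow> 'e \<Rightarrow> real) \<Rightarrow>
   ('b::topological_space, 'f::euclidean_space) chart set \<Rightarrow> ('b \<Rightarrow> 'f \<Rightarrow> 'f \<Rightarrow> real) \<Rightarrow>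
   ('a \<Rightarrow> 'b) \<Rightarrow> bool" where
  "riemannian_submersion A g B h F \<longleftrightarrow>
     smooth_map A B F \<and> surj F \<and> (\<forall>p. surj (differential A B F p)) \<and>
     (\<forall>p. \<forall>v\<in>horizontal_space A g B F p. \<forall>w\<in>horizontal_space A g B F p.
        h (F p) (differential A B F p v) (differential A B F p w) = g p v w)"

text \<open>\<open>(I, J, K)\<close> is a h-anti-invariant basis for \<open>F\<close>.\<close>

definition h_anti_invariant_submersion ::
  "('a::topological_space, 'e::euclidean_space) chart set \<Rightarrow>
   ('a \<Rightarrow> 'e \<Rightarrow> 'e) \<Rightarrow> ('a \<Rightarrow> 'e \<Rightarrow> 'e) \<Rightarrow> ('a \<Rightarrow> 'e \<Rightarrow> 'e) \<Rightarrow> ('a \<Rightarrow> 'e \<Rightarrow> 'e \<Rightarrow> real) \<Rightarrow>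
   ('b::topological_space, 'f::euclidean_space) chart set \<Rightarrow> ('b \<Rightarrow> 'f \<Rightarrow> 'f \<Rightarrow> real) \<Rightarrow>
   ('a \<Rightarrow> 'b) \<Rightarrow> bool" where
  "h_anti_invariant_submersion A I J K g B h F \<longleftrightarrow>
     riemannian_submersion A g B h F \<and>
     (\<forall>R\<in>{I, J, K}. \<forall>p. R p ` vertical_space A B F p \<subseteq> horizontal_space A g B F p)"

definition vertical_fields ::
  "('a, 'e::euclidean_space) chart set \<Rightarrow> ('b, 'f::euclidean_space) chart set \<Rightarrow>
   ('a \<Rightarrow> 'b) \<Rightarrow> ('a \<Rightarrow> 'e) set" where
  "vertical_fields A B F = {V \<in> vector_fields A. \<forall>p. V p \<in> vertical_space A B F p}"

definition horizontal_fields ::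
  "('a, 'e::euclidean_space) chart set \<Rightarrow> ('a \<Rightarrow> 'e \<Rightarrow> 'e \<Rightarrow> real) \<Rightarrow>
   ('b, 'f::euclidean_space) chart set \<Rightarrow> ('a \<Rightarrow> 'b) \<Rightarrow> ('a \<Rightarrow> 'e) set" where
  "horizontal_fields A g B F = {X \<in> vector_fields A. \<forall>p. X p \<in> horizontal_space A g B F p}"

text \<open>Orthogonal projection onto a subspace \<open>S\<close> with respect to an inner product \<open>b\<close>.\<close>

definition orth_proj :: "('e::euclidean_space \<Rightarrow> 'e \<Rightarrow> real) \<Rightarrow> 'e set \<Rightarrow> 'e \<Rightarrow> 'e" where
  "orth_proj b S u = (THE v. v \<in> S \<and> (\<forall>s\<in>S. b (u - v) s = 0))"

definition vert ::
  "('a, 'e::euclidean_space) chart set \<Rightarrow> ('a \<Rightarrow> 'e \<Rightarrow> 'e \<Rightarrow> real) \<Rightarrow>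
   ('b, 'f::euclidean_space) chart set \<Rightarrow> ('a \<Rightarrow> 'b) \<Rightarrow> 'a \<Rightarrow> 'e \<Rightarrow> 'e" where
  "vert A g B F p = orth_proj (g p) (vertical_space A B F p)"

definition horiz ::
  "('a, 'e::euclidean_space) chart set \<Rightarrow> ('a \<Rightarrow> 'e \<Rightarrow> 'e \<Rightarrow> real) \<Rightarrow>
   ('b, 'f::euclidean_space) chart set \<Rightarrow> ('a \<Rightarrow> 'b) \<Rightarrow> 'a \<Rightarrow> 'e \<Rightarrow> 'e" where
  "horiz A g B F p = orth_proj (g p) (horizontal_space A g B F p)"

definition oneill_A ::
  "('a, 'e::euclidean_space) chart set \<Rightarrow> ('a \<Rightarrow> 'e \<Rightarrow> 'e \<Rightarrow> real) \<Rightarrow>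
   ('b, 'f::euclidean_space) chart set \<Rightarrow> ('a \<Rightarrow> 'b) \<Rightarrow> ('a \<Rightarrow> 'e \<Rightarrow> ('a \<Rightarrow> 'e) \<Rightarrow> 'e) \<Rightarrow>
   ('a \<Rightarrow> 'e) \<Rightarrow> ('a \<Rightarrow> 'e) \<Rightarrow> 'a \<Rightarrow> 'e" where
  "oneill_A A g B F nab U W p =
     horiz A g B F p (nab p (horiz A g B F p (U p)) (\<lambda>q. vert A g B F q (W q)))
   + vert A g B F p (nab p (horiz A g B F p (U p)) (\<lambda>q. horiz A g B F q (W q)))"

definition oneill_T ::
  "('a, 'e::euclidean_space) chart set \<Rightarrow> ('a \<Rightarrow> 'e \<Rightarrow> 'e \<Rightarrow> real) \<Rightarrow>
   ('b, 'f::euclidean_space) chart set \<Rightarrow> ('a \<Rightarrow> 'b) \<Rightarrow> ('a \<Rightarrow> 'e \<Rightarrow> ('a \<Rightarrow> 'e) \<Rightarrow> 'e) \<Rightarrow>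
   ('a \<Rightarrow> 'e) \<Rightarrow> ('a \<Rightarrow> 'e) \<Rightarrow> 'a \<Rightarrow> 'e" where
  "oneill_T A g B F nab U W p =
     horiz A g B F p (nab p (vert A g B F p (U p)) (\<lambda>q. vert A g B F q (W q)))
   + vert A g B F p (nab p (vert A g B F p (U p)) (\<lambda>q. horiz A g B F q (W q)))"

definition mu_space ::
  "('a, 'e::euclidean_space) chart set \<Rightarrow> ('a \<Rightarrow> 'e \<Rightarrow> 'e \<Rightarrow> real) \<Rightarrow>
   ('b, 'f::euclidean_space) chart set \<Rightarrow> ('a \<Rightarrow> 'b) \<Rightarrow> ('a \<Rightarrow> 'e \<Rightarrow> 'e) \<Rightarrow> 'a \<Rightarrow> 'e set" where
  "mu_space A g B F R p =
     {w \<in> horizontal_space A g B F p. \<forall>u\<in>R p ` vertical_space A B F p. g p w u = 0}"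

definition Q_proj ::
  "('a, 'e::euclidean_space) chart set \<Rightarrow> ('a \<Rightarrow> 'e \<Rightarrow> 'e \<Rightarrow> real) \<Rightarrow>
   ('b, 'f::euclidean_space) chart set \<Rightarrow> ('a \<Rightarrow> 'b) \<Rightarrow> ('a \<Rightarrow> 'e \<Rightarrow> 'e) \<Rightarrow> 'a \<Rightarrow> 'e \<Rightarrow> 'e" where
  "Q_proj A g B F R p = orth_proj (g p) (mu_space A g B F R p)"

end

theory Submission
  imports Defs "HOL-Real_Asymp.Real_Asymp"
begin

text \<open>For a vertical field \<open>V\<close> one has \<open>(\<nabla>F\<^sub>*)(U, V) = - F\<^sub>* (\<nabla>\<^sub>U V)\<close>. The form \<open>\<nabla>F\<^sub>*\<close> is symmetric, because both
  Levi-Civita connections are torsion-free, and it vanishes on pairs of horizontal fields: by metric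
  compatibility \<open>g\<^sub>N ((\<nabla>F\<^sub>*)(X, Y), F\<^sub>* Z)\<close> is symmetric in \<open>X, Y\<close> and skew in \<open>Y, Z\<close>. Hence \<open>F\<close> is totally
  geodesic iff \<open>\<nabla>\<^sub>U V\<close> is vertical for all vertical \<open>V\<close>. As \<open>R\<close> is parallel,
  \<open>\<nabla>\<^sub>U (R V) = R (\<nabla>\<^sub>U V)\<close>, so this says that \<open>\<nabla>\<^sub>U (R V)\<close> lies in the image under \<open>R\<close> of the vertical
  space, that is, that its components in the vertical space and in \<open>\<mu>\<^sub>R\<close> vanish.\<close>

section \<open>Calculus of smooth functions on open sets\<close>

text \<open>Connections act on globally defined smooth sections, while tangent spaces are identified
  with the model space through charts that jump from point to point. Local computations therefore
  use frames \<open>Y\<close> with coordinates \<open>y\<close> that are cut off to global smooth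
  objects, and a bump function shows that a connection sees only germs. The connection
  \<open>nabF\<close> is prescribed only on pullbacks of fields on \<open>N\<close>; near each point
  \<open>dF W\<close> is a combination of such pullbacks whose coefficients are the derivatives
  along \<open>W\<close> of the coordinates composed with \<open>F\<close>, so the Leibniz rule
  computes \<open>nabF\<close> on it. A second obstacle is the smoothness of \<open>\<H> W\<close>.
  Total geodesy tests arbitrary fields, the tensor conditions only vertical and horizontal ones, so
  a smooth field has to split into smooth parts. The horizontal part is obtained as the metric dual
  of a smooth one-form, and the dual is built by Gram-Schmidt in a local frame. The conditions for
  \<open>I\<close>, \<open>J\<close>, \<open>K\<close> are never compared with one another: each is
  matched with total geodesy by one lemma about a generic parallel \<open>R\<close>.\<close>

lemma Ck_on_Suc_has_derivative:
  assumes "Ck_on (Suc k) S f" "open S" "x \<in> S"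
  shows "(f has_derivative frechet_derivative f (at x)) (at x)"
  using assms by (auto simp: differentiable_on_eq_differentiable_at frechet_derivative_works)

lemma Ck_on_cong:
  assumes "open S" and "\<And>x. x \<in> S \<Longrightarrow> f x = g x" and "Ck_on k S f"
  shows "Ck_on k S g"
  using assms(2,3)
proof (induction k arbitrary: f g)
  case 0
  then show ?case
    by (metis Ck_on.simps(1) continuous_on_cong)
next
  case (Suc k)
  have d: "(g has_derivative frechet_derivative f (at x)) (at x)" if "x \<in> S" for x
    using has_derivative_transform_within_open[OF Ck_on_Suc_has_derivative[OF Suc.prems(2) assms(1) that] assms(1) that]
      Suc.prems(1) by auto
  have "frechet_derivative f (at x) = frechet_derivative g (at x)" if "x \<in> S" for x
    using frechet_derivative_at[OF d[OF that]] .
  then have "Ck_on k S (\<lambda>x. frechet_derivative g (at x) v)" for v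
    using Suc.prems(2) by (rule_tac Suc.IH[of "\<lambda>x. frechet_derivative f (at x) v"]) auto
  moreover have "g differentiable_on S"
    using d by (intro differentiable_at_imp_differentiable_on differentiableI)
  ultimately show ?case by simp
qed

text \<open>Allows any explicit derivative formula in place of the chosen
  \<open>frechet_derivative\<close>; on an open set derivatives are unique, so the two
  agree.\<close>

lemma Ck_on_SucI:
  assumes "open S" and d: "\<And>x. x \<in> S \<Longrightarrow> (f has_derivative f' x) (at x)"
    and "\<And>v. Ck_on k S (\<lambda>x. f' x v)"
  shows "Ck_on (Suc k) S f"
proof -
  have "f' x = frechet_derivative f (at x)" if "x \<in> S" for x
    using frechet_derivative_at[OF d[OF that]] .
  then have "Ck_on k S (\<lambda>x. frechet_derivative f (at x) v)" for v
    using assms by (rule_tac Ck_on_cong[of S "\<lambda>x. f' x v"]) auto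
  moreover have "f differentiable_on S"
    using d by (intro differentiable_at_imp_differentiable_on differentiableI)
  ultimately show ?thesis by simp
qed

lemma Ck_on_SucD: "Ck_on (Suc k) S f \<Longrightarrow> Ck_on k S f"
  by (induction k arbitrary: f) (auto intro: differentiable_imp_continuous_on)

lemma Ck_on_subset: "Ck_on k T f \<Longrightarrow> S \<subseteq> T \<Longrightarrow> Ck_on k S f"
  by (induction k arbitrary: f) (auto intro: continuous_on_subset differentiable_on_subset)

lemma Ck_on_const: "open S \<Longrightarrow> Ck_on k S (\<lambda>_. c)"
  by (induction k arbitrary: c) (auto simp del: Ck_on.simps(2) intro!: Ck_on_SucI derivative_eq_intros)

lemma Ck_on_ident: "open S \<Longrightarrow> Ck_on k S (\<lambda>x. x)"
  by (cases k) (auto simp del: Ck_on.simps(2) intro!: Ck_on_SucI[where f' = "\<lambda>x h. h"] Ck_on_const)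

lemma Ck_on_bounded_linear:
  assumes "bounded_linear h" "open S" "Ck_on k S f"
  shows "Ck_on k S (\<lambda>x. h (f x))"
  using assms(3)
proof (induction k arbitrary: f)
  case 0
  then show ?case using assms(1) by (simp add: bounded_linear.continuous_on)
next
  case (Suc k)
  show ?case
  proof (rule Ck_on_SucI[OF assms(2)])
    show "((\<lambda>x. h (f x)) has_derivative (\<lambda>v. h (frechet_derivative f (at x) v))) (at x)" if "x \<in> S" for x
      using bounded_linear.has_derivative[OF assms(1) Ck_on_Suc_has_derivative[OF Suc.prems assms(2) that]] .
    show "Ck_on k S (\<lambda>x. h (frechet_derivative f (at x) v))" for v
      using Suc by simp
  qed
qed

lemma Ck_on_add:
  assumes "open S" "Ck_on k S f" "Ck_on k S g"
  shows "Ck_on k S (\<lambda>x. f x + g x)"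
  using assms(2,3)
proof (induction k arbitrary: f g)
  case 0
  then show ?case by (simp add: continuous_on_add)
next
  case (Suc k)
  show ?case
  proof (rule Ck_on_SucI[OF assms(1)])
    show "((\<lambda>x. f x + g x) has_derivative
        (\<lambda>v. frechet_derivative f (at x) v + frechet_derivative g (at x) v)) (at x)" if "x \<in> S" for x
      using has_derivative_add[OF Ck_on_Suc_has_derivative[OF Suc.prems(1) assms(1) that]
          Ck_on_Suc_has_derivative[OF Suc.prems(2) assms(1) that]] .
    show "Ck_on k S (\<lambda>x. frechet_derivative f (at x) v + frechet_derivative g (at x) v)" for v
      using Suc by simp
  qed
qed

text \<open>The product rule yields two products of the same shape, one with \<open>f\<close> and
  one with \<open>g\<close> differentiated, so the induction has to vary both factors.\<close>

lemma Ck_on_bounded_bilinear: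
  assumes "bounded_bilinear h" "open S" "Ck_on k S f" "Ck_on k S g"
  shows "Ck_on k S (\<lambda>x. h (f x) (g x))"
  using assms(3,4)
proof (induction k arbitrary: f g)
  case 0
  then show ?case using assms(1) by (simp add: bounded_bilinear.continuous_on)
next
  case (Suc k)
  show ?case
  proof (rule Ck_on_SucI[OF assms(2)])
    show "((\<lambda>x. h (f x) (g x)) has_derivative
        (\<lambda>v. h (f x) (frechet_derivative g (at x) v) + h (frechet_derivative f (at x) v) (g x))) (at x)"
      if "x \<in> S" for x
      using bounded_bilinear.FDERIV[OF assms(1) Ck_on_Suc_has_derivative[OF Suc.prems(1) assms(2) that]
          Ck_on_Suc_has_derivative[OF Suc.prems(2) assms(2) that]] .
    show "Ck_on k S (\<lambda>x. h (f x) (frechet_derivative g (at x) v) + h (frechet_derivative f (at x) v) (g x))" for v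
      using Suc.prems Ck_on_SucD[OF Suc.prems(1)] Ck_on_SucD[OF Suc.prems(2)]
      by (intro Ck_on_add assms(2) Suc.IH) auto
  qed
qed

lemma Ck_on_sum:
  assumes "open S" "\<And>i. i \<in> B \<Longrightarrow> Ck_on k S (f i)"
  shows "Ck_on k S (\<lambda>x. \<Sum>i\<in>B. f i x)"
  using assms(2) by (induction B rule: infinite_finite_induct) (simp_all add: Ck_on_const Ck_on_add assms(1))

text \<open>The derivative of \<open>inverse (f x)\<close> is a product of the reciprocal itself,
  one order lower, with a derivative of \<open>f\<close>; the induction thus stays with the same
  \<open>f\<close>.\<close>

lemma Ck_on_inverse:
  fixes f :: "'e::euclidean_space \<Rightarrow> real"
  assumes "open S" "\<And>x. x \<in> S \<Longrightarrow> f x \<noteq> 0" "Ck_on k S f"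
  shows "Ck_on k S (\<lambda>x. inverse (f x))"
  using assms(3)
proof (induction k)
  case 0
  then show ?case using assms(2) by (auto intro: continuous_on_inverse)
next
  case (Suc k)
  show ?case
  proof (rule Ck_on_SucI[OF assms(1)])
    show "((\<lambda>x. inverse (f x)) has_derivative
        (\<lambda>v. - (inverse (f x) * frechet_derivative f (at x) v * inverse (f x)))) (at x)"
      if "x \<in> S" for x
      using Deriv.has_derivative_inverse[OF assms(2)[OF that] Ck_on_Suc_has_derivative[OF Suc.prems assms(1) that]] .
    have "Ck_on k S (\<lambda>x. inverse (f x))" using Suc Ck_on_SucD by blast
    then show "Ck_on k S (\<lambda>x. - (inverse (f x) * frechet_derivative f (at x) v * inverse (f x)))" for v
      using Suc.prems assms(1)
      by (intro Ck_on_bounded_linear[OF bounded_linear_minus[OF bounded_linear_ident]]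
            Ck_on_bounded_bilinear[OF bounded_bilinear_mult]) auto
  qed
qed

text \<open>The chain rule differentiates \<open>g\<close> in a direction that moves with
  \<open>x\<close>, whereas \<open>Ck_on\<close> controls derivatives in fixed directions only.
  Expanding the direction in \<open>Basis\<close> separates the two.\<close>

lemma Ck_on_compose:
  assumes "open S" "open T" "f ` S \<subseteq> T" "Ck_on k T g" "Ck_on k S f"
  shows "Ck_on k S (\<lambda>x. g (f x))"
  using assms(4,5)
proof (induction k arbitrary: g)
  case 0
  then show ?case using assms(3) by (auto intro: continuous_on_compose2)
next
  case (Suc k)
  have fx: "f x \<in> T" if "x \<in> S" for x using that assms(3) by auto
  have lin: "linear (frechet_derivative g (at (f x)))" if "x \<in> S" for x
    using has_derivative_linear[OF Ck_on_Suc_has_derivative[OF Suc.prems(1) assms(2) fx[OF that]]] .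
  show ?case
  proof (rule Ck_on_SucI[OF assms(1)])
    show "((\<lambda>x. g (f x)) has_derivative
        (\<lambda>v. \<Sum>b\<in>Basis. (frechet_derivative f (at x) v \<bullet> b) *\<^sub>R frechet_derivative g (at (f x)) b)) (at x)"
      if "x \<in> S" for x
    proof -
      have chain: "((\<lambda>x. g (f x)) has_derivative (\<lambda>v. frechet_derivative g (at (f x)) (frechet_derivative f (at x) v))) (at x)"
        using diff_chain_at[OF Ck_on_Suc_has_derivative[OF Suc.prems(2) assms(1) that]
            Ck_on_Suc_has_derivative[OF Suc.prems(1) assms(2) fx[OF that]]] by (simp add: o_def)
      have rep: "frechet_derivative g (at (f x)) w = (\<Sum>b\<in>Basis. (w \<bullet> b) *\<^sub>R frechet_derivative g (at (f x)) b)" for w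
      proof -
        have "frechet_derivative g (at (f x)) w = frechet_derivative g (at (f x)) (\<Sum>b\<in>Basis. (w \<bullet> b) *\<^sub>R b)"
          by (simp add: euclidean_representation)
        then show ?thesis
          by (simp add: linear_sum[OF lin[OF that]] linear_scale[OF lin[OF that]])
      qed
      show ?thesis using chain unfolding rep[symmetric] .
    qed
    show "Ck_on k S (\<lambda>x. \<Sum>b\<in>Basis. (frechet_derivative f (at x) v \<bullet> b) *\<^sub>R frechet_derivative g (at (f x)) b)" for v
      using Suc.prems assms(1) Ck_on_SucD[OF Suc.prems(2)]
      by (intro Ck_on_sum Ck_on_bounded_bilinear[OF bounded_bilinear_scaleR]
          Ck_on_bounded_linear[OF bounded_linear_inner_left] Suc.IH) auto
  qed
qed

lemma Ck_on_local:
  assumes "\<And>x. x \<in> S \<Longrightarrow> \<exists>T. open T \<and> x \<in> T \<and> Ck_on k T f"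
  shows "Ck_on k S f"
  using assms
proof (induction k arbitrary: f)
  case 0
  have "continuous (at x) f" if "x \<in> S" for x
    using 0[OF that] by (auto simp: continuous_on_eq_continuous_at)
  then show ?case by (simp add: continuous_at_imp_continuous_on)
next
  case (Suc k)
  have "f differentiable (at x)" if "x \<in> S" for x
    using Suc.prems[OF that] by (auto simp: differentiable_on_eq_differentiable_at)
  moreover have "Ck_on k S (\<lambda>x. frechet_derivative f (at x) v)" for v
    using Suc.prems by (intro Suc.IH) fastforce
  ultimately show ?case by (auto simp: differentiable_on_def intro: differentiable_at_withinI)
qed

lemma smooth_on_differentiable: "smooth_on S f \<Longrightarrow> open S \<Longrightarrow> x \<in> S \<Longrightarrow> f differentiable (at x)"
  unfolding smooth_on_def by (metis Ck_on.simps(2) differentiable_on_eq_differentiable_at)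

lemma smooth_on_has_derivative:
  "smooth_on S f \<Longrightarrow> open S \<Longrightarrow> x \<in> S \<Longrightarrow> (f has_derivative frechet_derivative f (at x)) (at x)"
  using smooth_on_differentiable frechet_derivative_works by blast

lemma smooth_on_frechet_derivative:
  "smooth_on S f \<Longrightarrow> smooth_on S (\<lambda>x. frechet_derivative f (at x) v)"
  unfolding smooth_on_def by (metis Ck_on.simps(2))

lemma smooth_on_cong: "open S \<Longrightarrow> (\<And>x. x \<in> S \<Longrightarrow> f x = g x) \<Longrightarrow> smooth_on S f \<Longrightarrow> smooth_on S g"
  unfolding smooth_on_def using Ck_on_cong by blast

lemma smooth_on_subset: "smooth_on T f \<Longrightarrow> S \<subseteq> T \<Longrightarrow> smooth_on S f"
  unfolding smooth_on_def using Ck_on_subset by blast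

lemma smooth_on_local:
  "(\<And>x. x \<in> S \<Longrightarrow> \<exists>T. open T \<and> x \<in> T \<and> smooth_on T f) \<Longrightarrow> smooth_on S f"
  unfolding smooth_on_def by (intro allI Ck_on_local) blast

lemma smooth_on_const: "open S \<Longrightarrow> smooth_on S (\<lambda>_. c)"
  by (simp add: smooth_on_def Ck_on_const)

lemma smooth_on_ident: "open S \<Longrightarrow> smooth_on S (\<lambda>x. x)"
  by (simp add: smooth_on_def Ck_on_ident)

lemma smooth_on_bounded_linear: "bounded_linear h \<Longrightarrow> open S \<Longrightarrow> smooth_on S f \<Longrightarrow> smooth_on S (\<lambda>x. h (f x))"
  by (simp add: smooth_on_def Ck_on_bounded_linear)

lemma smooth_on_add: "open S \<Longrightarrow> smooth_on S f \<Longrightarrow> smooth_on S g \<Longrightarrow> smooth_on S (\<lambda>x. f x + g x)"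
  by (simp add: smooth_on_def Ck_on_add)

lemma smooth_on_sum:
  "open S \<Longrightarrow> (\<And>i. i \<in> B \<Longrightarrow> smooth_on S (f i)) \<Longrightarrow> smooth_on S (\<lambda>x. \<Sum>i\<in>B. f i x)"
  by (simp add: smooth_on_def Ck_on_sum)

lemma smooth_on_bounded_bilinear:
  "bounded_bilinear h \<Longrightarrow> open S \<Longrightarrow> smooth_on S f \<Longrightarrow> smooth_on S g \<Longrightarrow> smooth_on S (\<lambda>x. h (f x) (g x))"
  by (simp add: smooth_on_def Ck_on_bounded_bilinear)

lemmas smooth_on_scaleR = smooth_on_bounded_bilinear[OF bounded_bilinear_scaleR]
lemmas smooth_on_mult = smooth_on_bounded_bilinear[OF bounded_bilinear_mult[where 'a = real]]
lemmas smooth_on_inner = smooth_on_bounded_bilinear[OF bounded_bilinear_inner]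

lemma smooth_on_inverse:
  fixes f :: "'e::euclidean_space \<Rightarrow> real"
  shows "open S \<Longrightarrow> (\<And>x. x \<in> S \<Longrightarrow> f x \<noteq> 0) \<Longrightarrow> smooth_on S f \<Longrightarrow> smooth_on S (\<lambda>x. inverse (f x))"
  by (simp add: smooth_on_def Ck_on_inverse)

lemma smooth_on_compose:
  "open S \<Longrightarrow> open T \<Longrightarrow> f ` S \<subseteq> T \<Longrightarrow> smooth_on T g \<Longrightarrow> smooth_on S f \<Longrightarrow> smooth_on S (\<lambda>x. g (f x))"
  by (simp add: smooth_on_def Ck_on_compose)

section \<open>Flat functions and bump functions on Euclidean space\<close>

text \<open>The linear span of these functions is closed under differentiation, so that smoothness at \<open>0\<close>
  of all of them follows by a single induction.\<close>

definition flat_exp :: "nat \<Rightarrow> real \<Rightarrow> real" where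
  "flat_exp k t = (if t > 0 then exp (- 1 / t) / t ^ k else 0)"

lemma flat_exp_has_real_derivative:
  "(flat_exp k has_real_derivative flat_exp (k + 2) t - real k * flat_exp (k + 1) t) (at t)"
proof (cases t "0::real" rule: linorder_cases)
  case less
  have "((\<lambda>_. 0) has_real_derivative 0) (at t)" by simp
  then have "(flat_exp k has_real_derivative 0) (at t)"
    by (rule has_field_derivative_transform_within_open[where S = "{..<0}"]) (use less in \<open>auto simp: flat_exp_def\<close>)
  then show ?thesis using less by (simp add: flat_exp_def)
next
  case equal
  \<comment> \<open>The claimed derivative at \<open>0\<close> is \<open>0\<close>. From the right
    the exponential decay beats every power of \<open>1 / h\<close>; from the left the quotient is
    identically \<open>0\<close>.\<close>
  have "((\<lambda>h. flat_exp k h / h) \<longlongrightarrow> 0) (at_right 0)"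
  proof (rule Lim_transform_eventually)
    show "((\<lambda>h::real. exp (- 1 / h) / h ^ k / h) \<longlongrightarrow> 0) (at_right 0)" by real_asymp
    show "\<forall>\<^sub>F h in at_right 0. exp (- 1 / h) / h ^ k / h = flat_exp k h / h"
      by (simp add: eventually_at_filter flat_exp_def)
  qed
  moreover have "((\<lambda>h. flat_exp k h / h) \<longlongrightarrow> 0) (at_left 0)"
    by (rule Lim_transform_eventually[OF tendsto_const]) (simp add: eventually_at_filter flat_exp_def)
  ultimately have "((\<lambda>h. flat_exp k h / h) \<longlongrightarrow> 0) (at 0)"
    by (simp add: filterlim_split_at)
  then show ?thesis using equal by (simp add: DERIV_def flat_exp_def)
next
  case greater
  have "((\<lambda>t. exp (- 1 / t) / t ^ k) has_real_derivative flat_exp (k + 2) t - real k * flat_exp (k + 1) t) (at t)"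
    using greater
    by (auto intro!: derivative_eq_intros simp: flat_exp_def field_simps power2_eq_square)
       (cases k; simp add: field_simps)
  then show ?thesis
    by (rule has_field_derivative_transform_within_open[where S = "{0<..}"]) (use greater in \<open>auto simp: flat_exp_def\<close>)
qed

lemma Ck_on_flat_exp: "Ck_on n UNIV (flat_exp k)"
proof (induction n arbitrary: k)
  case 0
  then show ?case
    using DERIV_isCont[OF flat_exp_has_real_derivative] by (simp add: continuous_at_imp_continuous_on)
next
  case (Suc n)
  show ?case
  proof (rule Ck_on_SucI)
    show "(flat_exp k has_derivative (\<lambda>v. flat_exp (k + 2) t * v + (- real k * v) * flat_exp (k + 1) t)) (at t)" for t
      using flat_exp_has_real_derivative[of k t] unfolding has_field_derivative_def
      by (rule has_derivative_eq_rhs) (simp add: algebra_simps fun_eq_iff)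
    show "Ck_on n UNIV (\<lambda>t. flat_exp (k + 2) t * v + (- real k * v) * flat_exp (k + 1) t)" for v
      by (intro Ck_on_add Ck_on_bounded_bilinear[OF bounded_bilinear_mult] Ck_on_const Suc) auto
  qed simp
qed

lemma smooth_on_flat_exp: "smooth_on UNIV (flat_exp k)"
  by (simp add: smooth_on_def Ck_on_flat_exp)

lemma euclidean_bump_function:
  fixes z :: "'e::euclidean_space"
  assumes "r > 0"
  obtains \<beta> :: "'e \<Rightarrow> real"
  where "smooth_on UNIV \<beta>" and "\<And>x. x \<in> ball z (r / 2) \<Longrightarrow> \<beta> x = 1"
    and "\<And>x. x \<notin> cball z r \<Longrightarrow> \<beta> x = 0" and "\<And>x. 0 \<le> \<beta> x \<and> \<beta> x \<le> 1"
proof -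
  \<comment> \<open>\<open>P\<close> is positive exactly inside the ball of radius \<open>r\<close>,
    and \<open>N\<close> exactly outside the closed ball of radius \<open>r / 2\<close>. These sets
    cover the space, so \<open>P + N\<close> has no zero and \<open>P / (P + N)\<close> is the bump.
    Differences are written as sums so that the closure rules apply.\<close>
  define m where "m x = (x - z) \<bullet> (x - z)" for x
  define P where "P x = flat_exp 0 (r\<^sup>2 + - m x)" for x
  define N where "N x = flat_exp 0 (m x + - (r / 2)\<^sup>2)" for x
  have m: "m x = (dist z x)\<^sup>2" for x
    by (simp add: m_def dist_norm power2_norm_eq_inner norm_minus_commute)
  have sm: "smooth_on UNIV m"
    unfolding m_def diff_conv_add_uminus
    by (intro smooth_on_inner smooth_on_add smooth_on_ident smooth_on_const) auto
  have sP: "smooth_on UNIV P" unfolding P_def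
    by (intro smooth_on_compose[OF _ _ _ smooth_on_flat_exp] smooth_on_add smooth_on_const
        smooth_on_bounded_linear[OF bounded_linear_minus[OF bounded_linear_ident]] sm) auto
  have sN: "smooth_on UNIV N" unfolding N_def
    by (intro smooth_on_compose[OF _ _ _ smooth_on_flat_exp] smooth_on_add smooth_on_const sm) auto
  have "(r / 2)\<^sup>2 < r\<^sup>2" using assms by (intro power_strict_mono) auto
  then have pos: "P x + N x > 0" and nn: "P x \<ge> 0" "N x \<ge> 0" for x
    by (auto simp: P_def N_def flat_exp_def intro: add_pos_pos)
  show ?thesis
  proof (rule that[of "\<lambda>x. P x * inverse (P x + N x)"])
    show "smooth_on UNIV (\<lambda>x. P x * inverse (P x + N x))"
      by (intro smooth_on_mult smooth_on_inverse smooth_on_add sP sN pos[THEN less_imp_neq, symmetric]) auto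
    show "P x * inverse (P x + N x) = 1" if "x \<in> ball z (r / 2)" for x
    proof -
      have "m x \<le> (r / 2)\<^sup>2" unfolding m using that by (intro power_mono) auto
      then have "N x = 0" by (simp add: N_def flat_exp_def)
      then show ?thesis using pos[of x] by simp
    qed
    show "P x * inverse (P x + N x) = 0" if "x \<notin> cball z r" for x
    proof -
      have "r\<^sup>2 \<le> m x" unfolding m using that assms by (intro power_mono) auto
      then show ?thesis by (simp add: P_def flat_exp_def)
    qed
    show "0 \<le> P x * inverse (P x + N x) \<and> P x * inverse (P x + N x) \<le> 1" for x
      using pos[of x] nn[of x] by (simp add: field_simps)
  qed
qed

section \<open>Charts, smooth functions and directional derivatives\<close>

lemma has_derivative_cong_open:
  assumes "(f has_derivative f') (at x)" "open S" "x \<in> S" "\<And>y. y \<in> S \<Longrightarrow> f y = g y"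
  shows "(g has_derivative f') (at x)"
  using has_derivative_transform_within_open[OF assms(1-3)] assms(4) by auto

context
  fixes A :: "('a::{t2_space, second_countable_topology}, 'e::euclidean_space) chart set"
  assumes A: "smooth_manifold A"
begin

lemma chart_is_chart: "c \<in> A \<Longrightarrow> is_chart c"
  using A by (auto simp: smooth_manifold_def)

lemma chart_open: "c \<in> A \<Longrightarrow> open (fst c)"
  using chart_is_chart by (auto simp: is_chart_def)

lemma chart_inv_left [simp]: "c \<in> A \<Longrightarrow> q \<in> fst c \<Longrightarrow> chart_inv c (snd c q) = q"
  using chart_is_chart by (auto simp: is_chart_def homeomorphism_def)

lemma chart_image_open:
  assumes "c \<in> A" "open N" "N \<subseteq> fst c"
  shows "open (snd c ` N)"
proof -
  have h: "homeomorphism (fst c) (snd c ` fst c) (snd c) (chart_inv c)" and o: "open (snd c ` fst c)"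
    using chart_is_chart[OF assms(1)] by (auto simp: is_chart_def)
  have "openin (top_of_set (snd c ` fst c)) (snd c ` N)"
    using homeomorphism_imp_open_map[OF h] assms by (metis open_subset)
  then show ?thesis using o openin_open_trans by blast
qed

lemma chart_continuous: "c \<in> A \<Longrightarrow> continuous_on (fst c) (snd c)"
  using chart_is_chart by (auto simp: is_chart_def homeomorphism_def)

lemma chart_inv_continuous: "c \<in> A \<Longrightarrow> continuous_on (snd c ` fst c) (chart_inv c)"
  using chart_is_chart by (auto simp: is_chart_def homeomorphism_def)

lemma chart_at: "chart_at A p \<in> A" "p \<in> fst (chart_at A p)"
proof -
  have "\<exists>c. c \<in> A \<and> p \<in> fst c"
    using A unfolding smooth_manifold_def by (metis UNIV_I UN_E)
  then show "chart_at A p \<in> A" "p \<in> fst (chart_at A p)"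
    unfolding chart_at_def by (metis (mono_tags, lifting) someI_ex)+
qed

lemma transition_smooth:
  "c \<in> A \<Longrightarrow> d \<in> A \<Longrightarrow> smooth_on (snd c ` (fst c \<inter> fst d)) (snd d \<circ> chart_inv c)"
  using A by (auto simp: smooth_manifold_def)

lemma overlap_open: "c \<in> A \<Longrightarrow> d \<in> A \<Longrightarrow> open (snd c ` (fst c \<inter> fst d))"
  by (intro chart_image_open) (auto intro: chart_open)

lemma transition_has_derivative:
  assumes "c \<in> A" "d \<in> A" "p \<in> fst c" "p \<in> fst d"
  shows "((snd d \<circ> chart_inv c) has_derivative frechet_derivative (snd d \<circ> chart_inv c) (at (snd c p))) (at (snd c p))"
  by (rule smooth_on_has_derivative[OF transition_smooth overlap_open]) (use assms in auto)

text \<open>Chain rule with the transition map: this is where compatibility of the charts enters,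
  and it makes differentiability at a point independent of the chart.\<close>

lemma has_derivative_change_chart:
  assumes "c \<in> A" "d \<in> A" "p \<in> fst c" "p \<in> fst d"
    and f: "((f \<circ> chart_inv c) has_derivative f') (at (snd c p))"
  shows "((f \<circ> chart_inv d) has_derivative
    (\<lambda>v. f' (frechet_derivative (snd c \<circ> chart_inv d) (at (snd d p)) v))) (at (snd d p))"
proof (rule has_derivative_cong_open[OF _ overlap_open[of d c]])
  have "((f \<circ> chart_inv c) has_derivative f') (at ((snd c \<circ> chart_inv d) (snd d p)))"
    using f assms by simp
  from diff_chain_at[OF transition_has_derivative[of d c p] this] assms
  show "(((f \<circ> chart_inv c) \<circ> (snd c \<circ> chart_inv d)) has_derivative
      (\<lambda>v. f' (frechet_derivative (snd c \<circ> chart_inv d) (at (snd d p)) v))) (at (snd d p))"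
    by (simp add: o_def)
qed (use assms in auto)

lemma in_chart_has_derivative:
  "d \<in> A \<Longrightarrow> p \<in> fst d \<Longrightarrow>
    ((snd d \<circ> chart_inv (chart_at A p)) has_derivative in_chart A d p) (at (snd (chart_at A p) p))"
  unfolding in_chart_def using transition_has_derivative[of "chart_at A p" d p] chart_at by simp

lemma linear_in_chart: "d \<in> A \<Longrightarrow> p \<in> fst d \<Longrightarrow> linear (in_chart A d p)"
  using in_chart_has_derivative has_derivative_linear by blast

lemma derivative_in_chart:
  assumes "c \<in> A" "p \<in> fst c" and f: "((f \<circ> chart_inv c) has_derivative f') (at (snd c p))"
  shows "((f \<circ> chart_inv (chart_at A p)) has_derivative (\<lambda>v. f' (in_chart A c p v))) (at (snd (chart_at A p) p))"
  using has_derivative_change_chart[OF assms(1) chart_at(1) assms(2) chart_at(2) f]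
  by (simp add: in_chart_def)

lemma chart_has_derivative_id:
  assumes "c \<in> A" "p \<in> fst c"
  shows "((snd c \<circ> chart_inv c) has_derivative (\<lambda>v. v)) (at (snd c p))"
  by (rule has_derivative_cong_open[OF has_derivative_ident, of "snd c ` fst c"])
     (use assms chart_is_chart in \<open>auto simp: is_chart_def\<close>)

text \<open>The coordinate field of the chart \<open>d\<close> in direction \<open>a\<close>, read
  in the chart that identifies the tangent space at \<open>q\<close>. On the domain of
  \<open>d\<close> it inverts \<open>in_chart A d q\<close>; elsewhere its value is meaningless, so
  it is cut off before use.\<close>

definition coord_field :: "('a, 'e) chart \<Rightarrow> 'e \<Rightarrow> 'a \<Rightarrow> 'e" where
  "coord_field d a q = frechet_derivative (snd (chart_at A q) \<circ> chart_inv d) (at (snd d q)) a"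

lemma in_chart_coord_field:
  assumes "c \<in> A" "d \<in> A" "q \<in> fst c" "q \<in> fst d"
  shows "in_chart A c q (coord_field d a q) = frechet_derivative (snd c \<circ> chart_inv d) (at (snd d q)) a"
  using frechet_derivative_at[OF has_derivative_change_chart[OF chart_at(1) assms(2) chart_at(2) assms(4)
        in_chart_has_derivative[OF assms(1,3)]]]
  unfolding coord_field_def by metis

lemma coord_field_in_chart:
  assumes "d \<in> A" "q \<in> fst d"
  shows "coord_field d (in_chart A d q v) q = v"
proof -
  have "((snd (chart_at A q) \<circ> chart_inv (chart_at A q)) has_derivative (\<lambda>v. coord_field d (in_chart A d q v) q))
      (at (snd (chart_at A q) q))"
    unfolding coord_field_def
    by (intro derivative_in_chart transition_has_derivative assms chart_at)
  from has_derivative_unique[OF this chart_has_derivative_id[OF chart_at]] show ?thesis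
    by metis
qed

lemma linear_coord_field: "d \<in> A \<Longrightarrow> q \<in> fst d \<Longrightarrow> linear (\<lambda>a. coord_field d a q)"
  unfolding coord_field_def
  using has_derivative_linear[OF transition_has_derivative[of d "chart_at A q" q]] chart_at by simp

section \<open>Smooth functions on a manifold\<close>

text \<open>One suitable chart near each point suffices, because the transition maps carry
  smoothness to all other charts of the atlas.\<close>

lemma smooth_functionsI:
  assumes "\<And>p. \<exists>c\<in>A. \<exists>N. open N \<and> p \<in> N \<and> N \<subseteq> fst c \<and> smooth_on (snd c ` N) (f \<circ> chart_inv c)"
  shows "f \<in> smooth_functions A"
  unfolding smooth_functions_def
proof (intro CollectI ballI smooth_on_local)
  fix d x assume d: "d \<in> A" and "x \<in> snd d ` fst d"
  then obtain p where p: "p \<in> fst d" "x = snd d p" by auto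
  obtain c N where c: "c \<in> A" "open N" "p \<in> N" "N \<subseteq> fst c" "smooth_on (snd c ` N) (f \<circ> chart_inv c)"
    using assms by blast
  have o: "open (snd d ` (N \<inter> fst d))"
    using c d by (intro chart_image_open) (auto intro: chart_open)
  have "smooth_on (snd d ` (N \<inter> fst d)) (\<lambda>x. (f \<circ> chart_inv c) ((snd c \<circ> chart_inv d) x))"
    by (rule smooth_on_compose[OF o chart_image_open[OF c(1,2,4)] _ c(5)
          smooth_on_subset[OF transition_smooth[OF d c(1)]]]) (use c d in auto)
  then have "smooth_on (snd d ` (N \<inter> fst d)) (f \<circ> chart_inv d)"
    by (rule smooth_on_cong[OF o, rotated]) (use c d in auto)
  then show "\<exists>T. open T \<and> x \<in> T \<and> smooth_on T (f \<circ> chart_inv d)"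
    using o p c(3) by blast
qed

lemma smooth_functionsD: "f \<in> smooth_functions A \<Longrightarrow> c \<in> A \<Longrightarrow> smooth_on (snd c ` fst c) (f \<circ> chart_inv c)"
  by (auto simp: smooth_functions_def)

lemma chart_range_open: "c \<in> A \<Longrightarrow> open (snd c ` fst c)"
  by (intro chart_image_open) (auto intro: chart_open)

lemma smooth_functions_local:
  assumes "\<And>p. \<exists>N g. open N \<and> p \<in> N \<and> g \<in> smooth_functions A \<and> (\<forall>q\<in>N. f q = g q)"
  shows "f \<in> smooth_functions A"
proof (rule smooth_functionsI)
  fix p
  obtain N g where N: "open N" "p \<in> N" "g \<in> smooth_functions A" "\<forall>q\<in>N. f q = g q"
    using assms by blast
  let ?c = "chart_at A p"
  have o: "open (snd ?c ` (N \<inter> fst ?c))"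
    using N by (intro chart_image_open chart_at) (auto intro: chart_open chart_at)
  have "smooth_on (snd ?c ` (N \<inter> fst ?c)) (g \<circ> chart_inv ?c)"
    by (rule smooth_on_subset[OF smooth_functionsD[OF N(3) chart_at(1)]]) auto
  then have "smooth_on (snd ?c ` (N \<inter> fst ?c)) (f \<circ> chart_inv ?c)"
    by (rule smooth_on_cong[OF o, rotated]) (use N chart_at in auto)
  then show "\<exists>c\<in>A. \<exists>N. open N \<and> p \<in> N \<and> N \<subseteq> fst c \<and> smooth_on (snd c ` N) (f \<circ> chart_inv c)"
    using N chart_at by (intro bexI[of _ ?c] exI[of _ "N \<inter> fst ?c"]) (auto intro: chart_open)
qed

lemma smooth_functions_const: "(\<lambda>_. k) \<in> smooth_functions A"
  unfolding smooth_functions_def o_def by (intro CollectI ballI smooth_on_const chart_range_open)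

lemma smooth_functions_add:
  "f \<in> smooth_functions A \<Longrightarrow> g \<in> smooth_functions A \<Longrightarrow> (\<lambda>q. f q + g q) \<in> smooth_functions A"
  by (auto simp: smooth_functions_def o_def intro!: smooth_on_add chart_range_open)

lemma smooth_functions_mult:
  "f \<in> smooth_functions A \<Longrightarrow> g \<in> smooth_functions A \<Longrightarrow> (\<lambda>q. f q * g q) \<in> smooth_functions A"
  by (auto simp: smooth_functions_def o_def intro!: smooth_on_mult chart_range_open)

lemma smooth_functions_diff:
  "f \<in> smooth_functions A \<Longrightarrow> g \<in> smooth_functions A \<Longrightarrow> (\<lambda>q. f q - g q) \<in> smooth_functions A"
  using smooth_functions_add[of f "\<lambda>q. - 1 * g q"] smooth_functions_mult[OF smooth_functions_const, of g "-1"]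
  by simp

lemma smooth_functions_sum:
  "(\<And>i. i \<in> B \<Longrightarrow> f i \<in> smooth_functions A) \<Longrightarrow> (\<lambda>q. \<Sum>i\<in>B. f i q) \<in> smooth_functions A"
  using smooth_functions_const smooth_functions_add by (induction B rule: infinite_finite_induct) auto

lemma smooth_functions_inverse:
  "f \<in> smooth_functions A \<Longrightarrow> (\<And>q. f q \<noteq> 0) \<Longrightarrow> (\<lambda>q. inverse (f q)) \<in> smooth_functions A"
  by (auto simp: smooth_functions_def o_def intro!: smooth_on_inverse chart_range_open)

lemma smooth_functions_continuous:
  assumes "f \<in> smooth_functions A"
  shows "continuous_on UNIV f"
proof -
  have "continuous (at p) f" for p
  proof -
    let ?c = "chart_at A p"
    have "continuous_on (snd ?c ` fst ?c) (f \<circ> chart_inv ?c)"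
      using smooth_functionsD[OF assms chart_at(1)[of p]] unfolding smooth_on_def by (metis Ck_on.simps(1))
    then have "continuous_on (fst ?c) (\<lambda>q. (f \<circ> chart_inv ?c) (snd ?c q))"
      using chart_continuous[OF chart_at(1)] by (rule continuous_on_compose2) auto
    then have "continuous_on (fst ?c) f"
      by (rule continuous_on_cong[THEN iffD1, rotated -1]) (auto simp: chart_at)
    then show ?thesis
      using chart_at chart_open by (metis continuous_on_eq_continuous_at)
  qed
  then show ?thesis by (simp add: continuous_at_imp_continuous_on)
qed

section \<open>Cutoff functions on a manifold\<close>

text \<open>A Euclidean bump is pulled back by a chart and extended by \<open>0\<close>. The closed
  set \<open>C\<close> is part of the result because later extensions by zero need an open set, its
  complement, on which \<open>\<eta>\<close> vanishes.\<close>

lemma bump_function: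
  assumes "open N" "p \<in> N"
  obtains \<eta> V C where "\<eta> \<in> smooth_functions A" "open V" "p \<in> V" "\<And>q. q \<in> V \<Longrightarrow> \<eta> q = 1"
    "closed C" "C \<subseteq> N" "\<And>q. q \<notin> C \<Longrightarrow> \<eta> q = 0" "\<And>q. 0 \<le> \<eta> q \<and> \<eta> q \<le> 1" "V \<subseteq> N"
proof -
  define c where "c = chart_at A p"
  have c: "c \<in> A" "p \<in> fst c" by (auto simp: c_def chart_at)
  have o: "open (snd c ` (N \<inter> fst c))"
    using c assms by (intro chart_image_open) (auto intro: chart_open)
  moreover have "snd c p \<in> snd c ` (N \<inter> fst c)" using c assms by auto
  ultimately obtain r where r: "r > 0" "cball (snd c p) r \<subseteq> snd c ` (N \<inter> fst c)"
    using open_contains_cball by metis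
  obtain \<beta> :: "'e \<Rightarrow> real" where \<beta>: "smooth_on UNIV \<beta>"
    "\<And>x. x \<in> ball (snd c p) (r / 2) \<Longrightarrow> \<beta> x = 1" "\<And>x. x \<notin> cball (snd c p) r \<Longrightarrow> \<beta> x = 0"
    "\<And>x. 0 \<le> \<beta> x \<and> \<beta> x \<le> 1"
    using euclidean_bump_function[OF r(1)] by blast
  define C where "C = chart_inv c ` cball (snd c p) r"
  define V where "V = chart_inv c ` ball (snd c p) (r / 2)"
  define \<eta> where "\<eta> q = (if q \<in> fst c then \<beta> (snd c q) else 0)" for q
  have cb: "cball (snd c p) r \<subseteq> snd c ` fst c" using r by blast
  have CN: "C \<subseteq> N \<inter> fst c" using r c by (auto simp: C_def)
  \<comment> \<open>Being closed in the chart domain would not suffice for the extension by zero. A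
    compact set in a Hausdorff space is closed in the whole manifold.\<close>
  have "compact C"
    unfolding C_def by (intro compact_continuous_image compact_cball continuous_on_subset[OF chart_inv_continuous[OF c(1)] cb])
  then have C: "closed C" by (rule compact_imp_closed)
  have "ball (snd c p) (r / 2) \<subseteq> cball (snd c p) r" using r(1) by (auto simp: subset_iff)
  then have VC: "V \<subseteq> C" and bs: "ball (snd c p) (r / 2) \<subseteq> snd c ` fst c"
    using cb by (auto simp: V_def C_def)
  have "V = fst c \<inter> snd c -` ball (snd c p) (r / 2)"
  proof (intro equalityI subsetI)
    fix q assume "q \<in> fst c \<inter> snd c -` ball (snd c p) (r / 2)"
    then show "q \<in> V" unfolding V_def using c(1) by (metis IntD1 IntD2 vimageD chart_inv_left imageI)
  qed (use bs c(1) in \<open>auto simp: V_def\<close>)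
  then have V: "open V"
    using continuous_open_preimage[OF chart_continuous[OF c(1)] chart_open[OF c(1)]] by auto
  have z: "\<eta> q = 0" if "q \<notin> C" for q
    using that \<beta>(3)[of "snd c q"] c(1) unfolding \<eta>_def C_def by (auto simp: image_iff) (metis c(1) chart_inv_left mem_cball)
  have sm: "\<eta> \<in> smooth_functions A"
  proof (rule smooth_functionsI)
    fix q
    show "\<exists>c\<in>A. \<exists>N. open N \<and> q \<in> N \<and> N \<subseteq> fst c \<and> smooth_on (snd c ` N) (\<eta> \<circ> chart_inv c)"
    proof (cases "q \<in> C")
      case True
      have "smooth_on (snd c ` fst c) (\<eta> \<circ> chart_inv c)"
        by (rule smooth_on_cong[OF chart_range_open[OF c(1)] _ smooth_on_subset[OF \<beta>(1)]])
           (use c in \<open>auto simp: \<eta>_def\<close>)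
      then show ?thesis using True CN c chart_open by blast
    next
      case False
      let ?d = "chart_at A q"
      have o: "open (fst ?d - C)" using C chart_open[OF chart_at(1)] by blast
      have "smooth_on (snd ?d ` (fst ?d - C)) (\<eta> \<circ> chart_inv ?d)"
        by (rule smooth_on_cong[OF _ _ smooth_on_const[of _ 0]])
           (use o z chart_at chart_image_open in auto)
      then show ?thesis using False o chart_at by blast
    qed
  qed
  show ?thesis
  proof (rule that[OF sm V _ _ C _ z])
    show "p \<in> V" unfolding V_def using c r(1) by (metis centre_in_ball chart_inv_left half_gt_zero image_eqI)
    show "\<eta> q = 1" if "q \<in> V" for q
      using that \<beta>(2) bs c VC CN by (auto simp: V_def \<eta>_def subset_iff)
  qed (use CN VC \<beta>(4) in \<open>auto simp: \<eta>_def\<close>)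
qed

text \<open>Serves the Gram-Schmidt step, where \<open>f\<close> is the squared length of a field
  known to be nonzero only at \<open>p\<close>, yet the reciprocal must be a global smooth
  function.\<close>

lemma reciprocal_near:
  assumes "f \<in> smooth_functions A" "\<And>q. f q \<ge> 0" "f p \<noteq> 0"
  obtains r V where "r \<in> smooth_functions A" "open V" "p \<in> V" "\<And>q. q \<in> V \<Longrightarrow> r q * f q = 1"
proof -
  have "open (f -` (- {0}))"
    using smooth_functions_continuous[OF assms(1)] by (intro open_vimage) auto
  then obtain \<eta> V C where \<eta>: "\<eta> \<in> smooth_functions A" "open V" "p \<in> V" "\<And>q. q \<in> V \<Longrightarrow> \<eta> q = 1"
    "closed C" "C \<subseteq> f -` (- {0})" "\<And>q. q \<notin> C \<Longrightarrow> \<eta> q = 0" "\<And>q. 0 \<le> \<eta> q \<and> \<eta> q \<le> 1" "V \<subseteq> f -` (- {0})"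
    using bump_function[of "f -` (- {0})" p] assms(3) by blast
  \<comment> \<open>The bump is \<open>1\<close> only where \<open>f > 0\<close>, so \<open>f + (1 - \<eta>)\<close> has no zeros and agrees with \<open>f\<close> near \<open>p\<close>.\<close>
  have nz: "f q + (1 - \<eta> q) \<noteq> 0" for q
    using assms(2)[of q] \<eta>(6) \<eta>(7,8)[of q] by (cases "q \<in> C") (auto simp: add_nonneg_eq_0_iff)
  show ?thesis
  proof (rule that[OF _ \<eta>(2,3)])
    show "(\<lambda>q. inverse (f q + (1 - \<eta> q))) \<in> smooth_functions A"
      by (intro smooth_functions_inverse smooth_functions_add smooth_functions_diff smooth_functions_const assms \<eta> nz)
    show "inverse (f q + (1 - \<eta> q)) * f q = 1" if "q \<in> V" for q
    proof -
      have "f q \<noteq> 0" using \<eta>(9) that by auto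
      then show ?thesis using \<eta>(4)[OF that] by simp
    qed
  qed
qed

section \<open>Directional derivatives of smooth functions\<close>

lemma dir_deriv_has_derivative:
  assumes "f \<in> smooth_functions A"
  shows "((f \<circ> chart_inv (chart_at A p)) has_derivative dir_deriv A f p) (at (snd (chart_at A p) p))"
proof -
  have "((f \<circ> chart_inv (chart_at A p)) has_derivative
     frechet_derivative (f \<circ> chart_inv (chart_at A p)) (at (snd (chart_at A p) p))) (at (snd (chart_at A p) p))"
    by (rule smooth_on_has_derivative[OF smooth_functionsD[OF assms chart_at(1)]])
       (use chart_at chart_range_open in auto)
  then show ?thesis by (simp add: dir_deriv_def[abs_def])
qed

lemma dir_deriv_eqI:
  assumes "((f \<circ> chart_inv (chart_at A p)) has_derivative f') (at (snd (chart_at A p) p))"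
  shows "dir_deriv A f p v = f' v"
  using frechet_derivative_at[OF assms] by (simp add: dir_deriv_def)

lemma linear_dir_deriv: "f \<in> smooth_functions A \<Longrightarrow> linear (dir_deriv A f p)"
  using dir_deriv_has_derivative has_derivative_linear by blast

lemma dir_deriv_const: "dir_deriv A (\<lambda>_. k) p v = 0"
  by (rule dir_deriv_eqI) (simp add: o_def)

lemma dir_deriv_add:
  "f \<in> smooth_functions A \<Longrightarrow> g \<in> smooth_functions A \<Longrightarrow>
    dir_deriv A (\<lambda>q. f q + g q) p v = dir_deriv A f p v + dir_deriv A g p v"
  using has_derivative_add[OF dir_deriv_has_derivative[of f p] dir_deriv_has_derivative[of g p]]
  by (intro dir_deriv_eqI) (simp add: o_def)

lemma dir_deriv_mult:
  "f \<in> smooth_functions A \<Longrightarrow> g \<in> smooth_functions A \<Longrightarrow>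
    dir_deriv A (\<lambda>q. f q * g q) p v = f p * dir_deriv A g p v + dir_deriv A f p v * g p"
  using has_derivative_mult[OF dir_deriv_has_derivative[of f p] dir_deriv_has_derivative[of g p]]
  by (intro dir_deriv_eqI) (simp add: o_def chart_at)

lemma dir_deriv_sum:
  "(\<And>i. i \<in> B \<Longrightarrow> f i \<in> smooth_functions A) \<Longrightarrow>
    dir_deriv A (\<lambda>q. \<Sum>i\<in>B. f i q) p v = (\<Sum>i\<in>B. dir_deriv A (f i) p v)"
  by (induction B rule: infinite_finite_induct)
     (simp_all add: dir_deriv_const dir_deriv_add smooth_functions_sum)

lemma dir_deriv_cong:
  assumes "f \<in> smooth_functions A" "open N" "p \<in> N" "\<And>q. q \<in> N \<Longrightarrow> f q = g q"
  shows "dir_deriv A g p v = dir_deriv A f p v"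
proof (rule dir_deriv_eqI, rule has_derivative_cong_open[OF dir_deriv_has_derivative[OF assms(1)]])
  let ?c = "chart_at A p"
  show "open (snd ?c ` (N \<inter> fst ?c))"
    using assms by (intro chart_image_open chart_at) (auto intro: chart_open chart_at)
qed (use assms chart_at in auto)

lemma dir_deriv_in_chart:
  assumes "f \<in> smooth_functions A" "c \<in> A" "p \<in> fst c"
  shows "dir_deriv A f p v = frechet_derivative (f \<circ> chart_inv c) (at (snd c p)) (in_chart A c p v)"
  by (intro dir_deriv_eqI derivative_in_chart assms smooth_on_has_derivative[OF smooth_functionsD])
     (use assms chart_range_open in auto)

end

section \<open>Local frames and sections along a map\<close>

lemma sections_alongD:
  "S \<in> sections_along A B F \<Longrightarrow> c \<in> A \<Longrightarrow> d \<in> B \<Longrightarrow>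
    smooth_on (snd c ` (fst c \<inter> F -` fst d)) ((\<lambda>p. in_chart B d (F p) (S p)) \<circ> chart_inv c)"
  by (auto simp: sections_along_def)

lemma vector_fieldsD:
  "X \<in> vector_fields A \<Longrightarrow> c \<in> A \<Longrightarrow> smooth_on (snd c ` fst c) ((\<lambda>p. in_chart A c p (X p)) \<circ> chart_inv c)"
  using sections_alongD[of X A A id c c] by (simp add: vector_fields_def)

text \<open>The fields \<open>Y\<close> and the functions \<open>y\<close> are global, because
  connections and \<open>smooth_functions\<close> accept nothing else; only their relations are
  restricted to \<open>V\<close>. There the differentials of the \<open>y a\<close> form the coframe
  dual to \<open>Y\<close>. Since the duality constants do not depend on the point, the frame fields
  commute, as for coordinate fields.\<close>

definition frame_on ::
  "('a::topological_space, 'e::euclidean_space) chart set \<Rightarrow> 'a set \<Rightarrow>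
   ('e \<Rightarrow> 'a \<Rightarrow> 'e) \<Rightarrow> ('e \<Rightarrow> 'a \<Rightarrow> real) \<Rightarrow> bool" where
  "frame_on A V Y y \<longleftrightarrow> open V \<and> (\<forall>a. Y a \<in> vector_fields A) \<and> (\<forall>a. y a \<in> smooth_functions A) \<and>
     (\<forall>q\<in>V. \<forall>v. v = (\<Sum>a\<in>Basis. dir_deriv A (y a) q v *\<^sub>R Y a q)) \<and>
     (\<forall>q\<in>V. \<forall>a\<in>Basis. \<forall>b\<in>Basis. dir_deriv A (y a) q (Y b q) = (if a = b then 1 else 0))"

lemma frame_onD:
  assumes "frame_on A V Y y"
  shows "open V" "Y a \<in> vector_fields A" "y a \<in> smooth_functions A"
    and "q \<in> V \<Longrightarrow> (\<Sum>a\<in>Basis. dir_deriv A (y a) q v *\<^sub>R Y a q) = v"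
    and "q \<in> V \<Longrightarrow> a \<in> Basis \<Longrightarrow> b \<in> Basis \<Longrightarrow> dir_deriv A (y a) q (Y b q) = (if a = b then 1 else 0)"
  using assms unfolding frame_on_def by auto

context
  fixes A :: "('a::{t2_space, second_countable_topology}, 'e::euclidean_space) chart set"
  assumes A: "smooth_manifold A"
begin

lemma dir_deriv_smooth:
  assumes "f \<in> smooth_functions A" "W \<in> vector_fields A"
  shows "(\<lambda>q. dir_deriv A f q (W q)) \<in> smooth_functions A"
  unfolding smooth_functions_def
proof (intro CollectI ballI)
  fix c assume c: "c \<in> A"
  let ?W = "\<lambda>x. in_chart A c (chart_inv c x) (W (chart_inv c x))"
  let ?D = "\<lambda>x. frechet_derivative (f \<circ> chart_inv c) (at x)"
  note o = chart_range_open[OF A c]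
  have sW: "smooth_on (snd c ` fst c) ?W"
    using vector_fieldsD[OF assms(2) c] by (simp add: o_def)
  have sf: "smooth_on (snd c ` fst c) (f \<circ> chart_inv c)"
    by (rule smooth_functionsD[OF A assms(1) c])
  \<comment> \<open>The direction \<open>?W x\<close> varies with \<open>x\<close>; its expansion in
    \<open>Basis\<close> leaves derivatives of \<open>f\<close> in fixed directions.\<close>
  have "smooth_on (snd c ` fst c) (\<lambda>x. \<Sum>b\<in>Basis. (?W x \<bullet> b) * ?D x b)"
    by (intro smooth_on_sum smooth_on_mult o smooth_on_inner sW smooth_on_const smooth_on_frechet_derivative sf)
  then show "smooth_on (snd c ` fst c) ((\<lambda>q. dir_deriv A f q (W q)) \<circ> chart_inv c)"
  proof (rule smooth_on_cong[OF o, rotated])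
    fix x assume x: "x \<in> snd c ` fst c"
    then obtain q where q: "q \<in> fst c" "x = snd c q" by auto
    have lin: "linear (?D x)"
      using smooth_on_has_derivative[OF sf o x] has_derivative_linear by blast
    have "?D x (?W x) = ?D x (\<Sum>b\<in>Basis. (?W x \<bullet> b) *\<^sub>R b)"
      by (simp add: euclidean_representation)
    also have "\<dots> = (\<Sum>b\<in>Basis. (?W x \<bullet> b) * ?D x b)"
      by (simp add: linear_sum[OF lin] linear_scale[OF lin])
    finally show "(\<Sum>b\<in>Basis. (?W x \<bullet> b) * ?D x b) = ((\<lambda>q. dir_deriv A f q (W q)) \<circ> chart_inv c) x"
      using q dir_deriv_in_chart[OF A assms(1) c q(1)] c A by simp
  qed
qed

text \<open>Read in another chart, the components of a coordinate field are derivatives of a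
  transition map, hence smooth on the overlap. At points outside the domain of \<open>d\<close> the
  field is zero on the open complement of \<open>C\<close>.\<close>

lemma cutoff_coord_field:
  assumes d: "d \<in> A" and \<eta>: "\<eta> \<in> smooth_functions A"
    and C: "closed C" "C \<subseteq> fst d" "\<And>q. q \<notin> C \<Longrightarrow> \<eta> q = 0"
  shows "(\<lambda>q. \<eta> q *\<^sub>R coord_field A d a q) \<in> vector_fields A"
  unfolding vector_fields_def sections_along_def
proof (intro CollectI ballI smooth_on_local)
  fix c c' x assume c: "c \<in> A" and c': "c' \<in> A" and x: "x \<in> snd c ` (fst c \<inter> id -` fst c')"
  let ?S = "(\<lambda>p. in_chart A c' (id p) (\<eta> p *\<^sub>R coord_field A d a p)) \<circ> chart_inv c"
  from x obtain q where q: "q \<in> fst c" "q \<in> fst c'" "x = snd c q" by auto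
  show "\<exists>T. open T \<and> x \<in> T \<and> smooth_on T ?S"
  proof (cases "q \<in> fst d")
    case True
    let ?N = "fst c \<inter> fst c' \<inter> fst d"
    let ?T = "snd c ` ?N"
    have o: "open ?T" using c c' d A by (intro chart_image_open[OF A c]) (auto intro: chart_open)
    let ?G = "\<lambda>x. frechet_derivative (snd c' \<circ> chart_inv d) (at x) a"
    have G: "smooth_on ?T (\<lambda>x. ?G ((snd d \<circ> chart_inv c) x))"
    proof (rule smooth_on_compose[OF o overlap_open[OF A d c'] _
          smooth_on_frechet_derivative[OF transition_smooth[OF A d c']]
          smooth_on_subset[OF transition_smooth[OF A c d]]])
      show "(snd d \<circ> chart_inv c) ` ?T \<subseteq> snd d ` (fst d \<inter> fst c')"
        using c A by auto
      show "?T \<subseteq> snd c ` (fst c \<inter> fst d)" by auto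
    qed
    have e: "smooth_on ?T (\<eta> \<circ> chart_inv c)"
      by (rule smooth_on_subset[OF smooth_functionsD[OF A \<eta> c]]) auto
    have "smooth_on ?T ?S"
    proof (rule smooth_on_cong[OF o _ smooth_on_scaleR[OF o e G]])
      fix y assume "y \<in> ?T"
      then obtain r where r: "r \<in> fst c" "r \<in> fst c'" "r \<in> fst d" "y = snd c r" by auto
      show "(\<eta> \<circ> chart_inv c) y *\<^sub>R ?G ((snd d \<circ> chart_inv c) y) = ?S y"
        using r c A in_chart_coord_field[OF A c' d r(2,3)] linear_scale[OF linear_in_chart[OF A c' r(2)]]
        by simp
    qed
    then show ?thesis using o q True by blast
  next
    case False
    let ?N = "fst c \<inter> fst c' - C"
    let ?T = "snd c ` ?N"
    have "open ?N" using c c' C A by (auto intro: chart_open)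
    then have o: "open ?T" using c A by (intro chart_image_open[OF A c]) auto
    have "smooth_on ?T ?S"
    proof (rule smooth_on_cong[OF o _ smooth_on_const[OF o, of 0]])
      fix y assume "y \<in> ?T"
      then obtain r where r: "r \<in> fst c" "r \<in> fst c'" "r \<notin> C" "y = snd c r" by auto
      show "0 = ?S y"
        using r c A C(3)[OF r(3)] linear_0[OF linear_in_chart[OF A c' r(2)]] by simp
    qed
    moreover have "q \<in> ?N" using q False C(2) by auto
    ultimately show ?thesis using o q by blast
  qed
qed

lemma local_frame:
  obtains V Y y where "x \<in> V" "frame_on A V Y y"
proof -
  define d where "d = chart_at A x"
  have d: "d \<in> A" "x \<in> fst d" using chart_at[OF A] by (auto simp: d_def)
  obtain \<eta> V C where \<eta>: "\<eta> \<in> smooth_functions A" "open V" "x \<in> V" "\<And>q. q \<in> V \<Longrightarrow> \<eta> q = 1"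
    "closed C" "C \<subseteq> fst d" "\<And>q. q \<notin> C \<Longrightarrow> \<eta> q = 0" "V \<subseteq> fst d"
    using bump_function[OF A chart_open[OF A d(1)] d(2)] by metis
  \<comment> \<open>On \<open>V\<close>, where \<open>\<eta>\<close> equals \<open>1\<close>, these
    are the coordinate fields and the coordinate functions of \<open>d\<close>.\<close>
  define Y where "Y a q = \<eta> q *\<^sub>R coord_field A d a q" for a q
  define y where "y a q = \<eta> q * (snd d q \<bullet> a)" for a q
  have Y: "Y a \<in> vector_fields A" for a
    unfolding Y_def[abs_def] by (rule cutoff_coord_field[OF d(1) \<eta>(1,5-7)])
  have y: "y a \<in> smooth_functions A" for a
  proof (rule smooth_functionsI[OF A])
    fix q
    show "\<exists>c\<in>A. \<exists>N. open N \<and> q \<in> N \<and> N \<subseteq> fst c \<and> smooth_on (snd c ` N) (y a \<circ> chart_inv c)"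
    proof (cases "q \<in> fst d")
      case True
      note o = chart_range_open[OF A d(1)]
      have "smooth_on (snd d ` fst d) (\<lambda>x. (\<eta> \<circ> chart_inv d) x * (x \<bullet> a))"
        by (intro smooth_on_mult smooth_on_inner smooth_on_ident smooth_on_const o smooth_functionsD[OF A \<eta>(1) d(1)])
      then have "smooth_on (snd d ` fst d) (y a \<circ> chart_inv d)"
        by (rule smooth_on_cong[OF o, rotated]) (use d A in \<open>auto simp: y_def\<close>)
      then show ?thesis using True d chart_open[OF A] by blast
    next
      case False
      let ?c = "chart_at A q"
      have N: "open (fst ?c - C)" using chart_open[OF A chart_at(1)[OF A]] \<eta>(5) by blast
      have o: "open (snd ?c ` (fst ?c - C))"
        by (rule chart_image_open[OF A chart_at(1)[OF A] N]) auto
      have "smooth_on (snd ?c ` (fst ?c - C)) (y a \<circ> chart_inv ?c)"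
        by (rule smooth_on_cong[OF o _ smooth_on_const[OF o, of 0]])
           (use \<eta>(7) chart_at[OF A] A in \<open>auto simp: y_def\<close>)
      moreover have "q \<in> fst ?c - C" using False \<eta>(6) chart_at[OF A] by blast
      ultimately show ?thesis using N chart_at(1)[OF A] by blast
    qed
  qed
  \<comment> \<open>As \<open>\<eta>\<close> is constant on the open set \<open>V\<close>, it
    contributes no derivative: only that of the linear coordinate remains.\<close>
  have dy: "dir_deriv A (y a) q v = in_chart A d q v \<bullet> a" if "q \<in> V" for a q v
  proof (rule dir_deriv_eqI[OF A])
    have "((y a \<circ> chart_inv d) has_derivative (\<lambda>v. v \<bullet> a)) (at (snd d q))"
      by (rule has_derivative_cong_open[where f = "\<lambda>x. x \<bullet> a" and S = "snd d ` V"])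
         (use that \<eta>(4,8) d A chart_image_open[OF A d(1) \<eta>(2,8)] in
          \<open>auto simp: y_def subset_iff intro!: derivative_eq_intros\<close>)
    then show "((y a \<circ> chart_inv (chart_at A q)) has_derivative (\<lambda>v. in_chart A d q v \<bullet> a)) (at (snd (chart_at A q) q))"
      by (rule derivative_in_chart[OF A d(1), rotated]) (use that \<eta>(8) in auto)
  qed
  have "frame_on A V Y y"
    unfolding frame_on_def
  proof (intro conjI ballI allI \<eta>(2) Y y)
    fix q v assume q: "q \<in> V"
    then have qd: "q \<in> fst d" using \<eta>(8) by auto
    have "v = coord_field A d (in_chart A d q v) q"
      using coord_field_in_chart[OF A d(1) qd] by simp
    also have "\<dots> = coord_field A d (\<Sum>a\<in>Basis. (in_chart A d q v \<bullet> a) *\<^sub>R a) q"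
      by (simp add: euclidean_representation)
    also have "\<dots> = (\<Sum>a\<in>Basis. (in_chart A d q v \<bullet> a) *\<^sub>R coord_field A d a q)"
      by (simp add: linear_sum[OF linear_coord_field[OF A d(1) qd]] linear_scale[OF linear_coord_field[OF A d(1) qd]])
    also have "\<dots> = (\<Sum>a\<in>Basis. dir_deriv A (y a) q v *\<^sub>R Y a q)"
      using q \<eta>(4) by (simp add: dy Y_def)
    finally show "v = (\<Sum>a\<in>Basis. dir_deriv A (y a) q v *\<^sub>R Y a q)" .
  next
    fix q and a b :: 'e assume q: "q \<in> V" and ab: "a \<in> Basis" "b \<in> Basis"
    then have qd: "q \<in> fst d" using \<eta>(8) by auto
    have "in_chart A d q (coord_field A d b q) = b"
      using in_chart_coord_field[OF A d(1,1) qd qd]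
        frechet_derivative_at[OF chart_has_derivative_id[OF A d(1) qd]] by metis
    then show "dir_deriv A (y a) q (Y b q) = (if a = b then 1 else 0)"
      using q ab \<eta>(4) by (simp add: dy Y_def inner_Basis)
  qed
  with \<eta>(3) that show ?thesis by blast
qed

end

section \<open>Sections along a map: algebra and locality\<close>

context
  fixes A :: "('a::{t2_space, second_countable_topology}, 'e::euclidean_space) chart set"
    and B :: "('b::{t2_space, second_countable_topology}, 'f::euclidean_space) chart set"
    and F :: "'a \<Rightarrow> 'b"
  assumes A: "smooth_manifold A" and B: "smooth_manifold B" and F: "continuous_on UNIV F"
begin

lemma preimage_chart_open: "d \<in> B \<Longrightarrow> open (F -` fst d)"
  using open_vimage[OF chart_open[OF B] F] .

lemma sections_domain_open: "c \<in> A \<Longrightarrow> d \<in> B \<Longrightarrow> open (snd c ` (fst c \<inter> F -` fst d))"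
  by (intro chart_image_open[OF A] open_Int preimage_chart_open chart_open[OF A]) auto

lemma sections_along_add:
  assumes "S \<in> sections_along A B F" "T \<in> sections_along A B F"
  shows "(\<lambda>q. S q + T q) \<in> sections_along A B F"
  unfolding sections_along_def
proof (intro CollectI ballI)
  fix c d assume cd: "c \<in> A" "d \<in> B"
  note o = sections_domain_open[OF cd]
  show "smooth_on (snd c ` (fst c \<inter> F -` fst d)) ((\<lambda>p. in_chart B d (F p) (S p + T p)) \<circ> chart_inv c)"
    by (rule smooth_on_cong[OF o _ smooth_on_add[OF o sections_alongD[OF assms(1) cd] sections_alongD[OF assms(2) cd]]])
       (use cd A linear_add[OF linear_in_chart[OF B cd(2)]] in auto)
qed

lemma sections_along_scale:
  assumes "f \<in> smooth_functions A" "S \<in> sections_along A B F"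
  shows "(\<lambda>q. f q *\<^sub>R S q) \<in> sections_along A B F"
  unfolding sections_along_def
proof (intro CollectI ballI)
  fix c d assume cd: "c \<in> A" "d \<in> B"
  note o = sections_domain_open[OF cd]
  have f: "smooth_on (snd c ` (fst c \<inter> F -` fst d)) (f \<circ> chart_inv c)"
    by (rule smooth_on_subset[OF smooth_functionsD[OF A assms(1) cd(1)]]) auto
  show "smooth_on (snd c ` (fst c \<inter> F -` fst d)) ((\<lambda>p. in_chart B d (F p) (f p *\<^sub>R S p)) \<circ> chart_inv c)"
    by (rule smooth_on_cong[OF o _ smooth_on_scaleR[OF o f sections_alongD[OF assms(2) cd]]])
       (use cd A linear_scale[OF linear_in_chart[OF B cd(2)]] in auto)
qed

lemma sections_along_0: "(\<lambda>_. 0) \<in> sections_along A B F"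
  unfolding sections_along_def
proof (intro CollectI ballI)
  fix c d assume cd: "c \<in> A" "d \<in> B"
  note o = sections_domain_open[OF cd]
  show "smooth_on (snd c ` (fst c \<inter> F -` fst d)) ((\<lambda>p. in_chart B d (F p) 0) \<circ> chart_inv c)"
    by (rule smooth_on_cong[OF o _ smooth_on_const[OF o, of 0]])
       (use cd A linear_0[OF linear_in_chart[OF B cd(2)]] in auto)
qed

lemma sections_along_diff:
  assumes "S \<in> sections_along A B F" "T \<in> sections_along A B F"
  shows "(\<lambda>q. S q - T q) \<in> sections_along A B F"
  using sections_along_add[OF assms(1) sections_along_scale[OF smooth_functions_const[OF A, of "-1"] assms(2)]]
  by simp

lemma sections_along_sum:
  "(\<And>i. i \<in> J \<Longrightarrow> S i \<in> sections_along A B F) \<Longrightarrow> (\<lambda>q. \<Sum>i\<in>J. S i q) \<in> sections_along A B F"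
  by (induction J rule: infinite_finite_induct) (simp_all add: sections_along_0 sections_along_add)

lemma sections_along_local:
  assumes "\<And>p. \<exists>N T. open N \<and> p \<in> N \<and> T \<in> sections_along A B F \<and> (\<forall>q\<in>N. S q = T q)"
  shows "S \<in> sections_along A B F"
  unfolding sections_along_def
proof (intro CollectI ballI smooth_on_local)
  fix c d x assume cd: "c \<in> A" "d \<in> B" and "x \<in> snd c ` (fst c \<inter> F -` fst d)"
  then obtain p where p: "p \<in> fst c" "F p \<in> fst d" "x = snd c p" by auto
  obtain N T where N: "open N" "p \<in> N" "T \<in> sections_along A B F" "\<forall>q\<in>N. S q = T q"
    using assms by blast
  let ?U = "snd c ` (fst c \<inter> F -` fst d \<inter> N)"
  have o: "open ?U"
    by (intro chart_image_open[OF A] open_Int preimage_chart_open chart_open[OF A] cd N(1)) auto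
  have "smooth_on ?U ((\<lambda>p. in_chart B d (F p) (T p)) \<circ> chart_inv c)"
    by (rule smooth_on_subset[OF sections_alongD[OF N(3) cd]]) auto
  then have "smooth_on ?U ((\<lambda>p. in_chart B d (F p) (S p)) \<circ> chart_inv c)"
    by (rule smooth_on_cong[OF o, rotated]) (use N cd A in auto)
  then show "\<exists>U. open U \<and> x \<in> U \<and> smooth_on U ((\<lambda>p. in_chart B d (F p) (S p)) \<circ> chart_inv c)"
    using o p N(2) by blast
qed

end

context
  fixes A :: "('a::{t2_space, second_countable_topology}, 'e::euclidean_space) chart set"
  assumes A: "smooth_manifold A"
begin

lemmas vector_fields_add = sections_along_add[OF A A continuous_on_id', folded vector_fields_def]
lemmas vector_fields_scale = sections_along_scale[OF A A continuous_on_id', folded vector_fields_def]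
lemmas vector_fields_0 = sections_along_0[OF A A continuous_on_id', folded vector_fields_def]
lemmas vector_fields_diff = sections_along_diff[OF A A continuous_on_id', folded vector_fields_def]
lemmas vector_fields_sum = sections_along_sum[OF A A continuous_on_id', folded vector_fields_def]
lemmas vector_fields_local = sections_along_local[OF A A continuous_on_id', folded vector_fields_def]

lemma extend_tangent_vector:
  obtains X where "X \<in> vector_fields A" "X p = v"
proof -
  obtain V Y y where fr: "p \<in> V" "frame_on A V Y y"
    using local_frame[OF A] by metis
  show ?thesis
  proof (rule that)
    show "(\<lambda>q. \<Sum>a\<in>Basis. dir_deriv A (y a) p v *\<^sub>R Y a q) \<in> vector_fields A"
      by (intro vector_fields_sum vector_fields_scale smooth_functions_const A frame_onD[OF fr(2)])
    show "(\<Sum>a\<in>Basis. dir_deriv A (y a) p v *\<^sub>R Y a p) = v"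
      by (rule frame_onD(4)[OF fr(2,1)])
  qed
qed

end

section \<open>The differential as a section of the pullback bundle\<close>

context
  fixes A :: "('a::{t2_space, second_countable_topology}, 'e::euclidean_space) chart set"
    and B :: "('b::{t2_space, second_countable_topology}, 'f::euclidean_space) chart set"
    and F :: "'a \<Rightarrow> 'b"
  assumes A: "smooth_manifold A" and B: "smooth_manifold B" and F: "smooth_map A B F"
begin

lemma smooth_map_continuous: "continuous_on UNIV F"
  using F by (simp add: smooth_map_def)

lemma smooth_mapD:
  "c \<in> A \<Longrightarrow> d \<in> B \<Longrightarrow> smooth_on (snd c ` (fst c \<inter> F -` fst d)) (snd d \<circ> F \<circ> chart_inv c)"
  using F by (auto simp: smooth_map_def)

lemma differential_has_derivative:
  "((snd (chart_at B (F p)) \<circ> F \<circ> chart_inv (chart_at A p)) has_derivative differential A B F p)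
     (at (snd (chart_at A p) p))"
  unfolding differential_def[abs_def]
  by (rule smooth_on_has_derivative[OF smooth_mapD sections_domain_open[OF A B smooth_map_continuous]])
     (use chart_at[OF A] chart_at[OF B] in auto)

lemma linear_differential: "linear (differential A B F p)"
  using differential_has_derivative has_derivative_linear by blast

lemma smooth_functions_compose:
  assumes "f \<in> smooth_functions B"
  shows "(\<lambda>q. f (F q)) \<in> smooth_functions A"
proof (rule smooth_functionsI[OF A])
  fix p
  let ?c = "chart_at A p" and ?d = "chart_at B (F p)"
  let ?N = "fst ?c \<inter> F -` fst ?d"
  have cd: "?c \<in> A" "?d \<in> B" "p \<in> ?N" using chart_at[OF A] chart_at[OF B] by auto
  have N: "open ?N"
    using preimage_chart_open[OF A B smooth_map_continuous cd(2)] chart_open[OF A cd(1)] by blast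
  note o = sections_domain_open[OF A B smooth_map_continuous cd(1,2)]
  have "smooth_on (snd ?c ` ?N) (\<lambda>x. (f \<circ> chart_inv ?d) ((snd ?d \<circ> F \<circ> chart_inv ?c) x))"
    by (rule smooth_on_compose[OF o chart_range_open[OF B cd(2)] _ smooth_functionsD[OF B assms cd(2)] smooth_mapD[OF cd(1,2)]])
       (use cd A in auto)
  then have "smooth_on (snd ?c ` ?N) ((\<lambda>q. f (F q)) \<circ> chart_inv ?c)"
    by (rule smooth_on_cong[OF o, rotated]) (use cd A B in auto)
  then show "\<exists>c\<in>A. \<exists>N. open N \<and> p \<in> N \<and> N \<subseteq> fst c \<and> smooth_on (snd c ` N) ((\<lambda>q. f (F q)) \<circ> chart_inv c)"
    using N cd by blast
qed

lemma dir_deriv_compose: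
  assumes "f \<in> smooth_functions B"
  shows "dir_deriv A (\<lambda>q. f (F q)) p u = dir_deriv B f (F p) (differential A B F p u)"
proof (rule dir_deriv_eqI[OF A])
  let ?c = "chart_at A p" and ?d = "chart_at B (F p)"
  have cd: "?c \<in> A" "?d \<in> B" "p \<in> fst ?c" "F p \<in> fst ?d" using chart_at[OF A] chart_at[OF B] by auto
  have "((f \<circ> chart_inv ?d) has_derivative dir_deriv B f (F p)) (at ((snd ?d \<circ> F \<circ> chart_inv ?c) (snd ?c p)))"
    using dir_deriv_has_derivative[OF B assms, of "F p"] cd A by simp
  from diff_chain_at[OF differential_has_derivative this]
  have ch: "((\<lambda>x. (f \<circ> chart_inv ?d) ((snd ?d \<circ> F \<circ> chart_inv ?c) x)) has_derivative
      (\<lambda>u. dir_deriv B f (F p) (differential A B F p u))) (at (snd ?c p))"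
    by (simp add: o_def)
  show "(((\<lambda>q. f (F q)) \<circ> chart_inv ?c) has_derivative
      (\<lambda>u. dir_deriv B f (F p) (differential A B F p u))) (at (snd ?c p))"
    by (rule has_derivative_cong_open[OF ch sections_domain_open[OF A B smooth_map_continuous cd(1,2)]])
       (use cd A B in auto)
qed

lemma pullback_field_section:
  assumes "Y \<in> vector_fields B"
  shows "(\<lambda>q. Y (F q)) \<in> sections_along A B F"
  unfolding sections_along_def
proof (intro CollectI ballI)
  fix c d assume cd: "c \<in> A" "d \<in> B"
  note o = sections_domain_open[OF A B smooth_map_continuous cd]
  let ?U = "snd c ` (fst c \<inter> F -` fst d)"
  let ?Y = "(\<lambda>p. in_chart B d p (Y p)) \<circ> chart_inv d"
  have "smooth_on ?U (\<lambda>x. ?Y ((snd d \<circ> F \<circ> chart_inv c) x))"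
    by (rule smooth_on_compose[OF o chart_range_open[OF B cd(2)] _ vector_fieldsD[OF assms cd(2)] smooth_mapD[OF cd]])
       (use cd A in auto)
  then show "smooth_on ?U ((\<lambda>p. in_chart B d (F p) (Y (F p))) \<circ> chart_inv c)"
    by (rule smooth_on_cong[OF o, rotated]) (use cd A B in auto)
qed

text \<open>By the chain rule the coordinates of \<open>dF w\<close> are derivatives of global
  smooth functions on the source. Calculations with the differential are thereby reduced to scalar
  components.\<close>

lemma differential_in_frame:
  assumes "frame_on B V Y y" "F q \<in> V"
  shows "differential A B F q w = (\<Sum>a\<in>Basis. dir_deriv A (\<lambda>q. y a (F q)) q w *\<^sub>R Y a (F q))"
  by (simp add: dir_deriv_compose frame_onD(3)[OF assms(1)] frame_onD(4)[OF assms])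

lemma differential_section:
  assumes W: "W \<in> vector_fields A"
  shows "(\<lambda>q. differential A B F q (W q)) \<in> sections_along A B F"
proof (rule sections_along_local[OF A B smooth_map_continuous])
  fix p
  obtain V Y y where fr: "F p \<in> V" "frame_on B V Y y"
    using local_frame[OF B] by metis
  let ?T = "\<lambda>q. \<Sum>a\<in>Basis. dir_deriv A (\<lambda>q. y a (F q)) q (W q) *\<^sub>R Y a (F q)"
  have "?T \<in> sections_along A B F"
    by (intro sections_along_sum[OF A B smooth_map_continuous] sections_along_scale[OF A B smooth_map_continuous]
        pullback_field_section frame_onD(2,3)[OF fr(2)] dir_deriv_smooth[OF A] smooth_functions_compose W)
  moreover have "open (F -` V)" using open_vimage[OF frame_onD(1)[OF fr(2)] smooth_map_continuous] .
  moreover have "differential A B F q (W q) = ?T q" if "q \<in> F -` V" for q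
    using differential_in_frame[OF fr(2)] that by blast
  ultimately show "\<exists>N T. open N \<and> p \<in> N \<and> T \<in> sections_along A B F \<and> (\<forall>q\<in>N. differential A B F q (W q) = T q)"
    using fr(1) by blast
qed

end

section \<open>Connections and Riesz duality for a metric\<close>

locale inner_form =
  fixes b :: "'e::euclidean_space \<Rightarrow> 'e \<Rightarrow> real"
  assumes bilin: "bilinear b" and sym: "b v w = b w v" and pos: "v \<noteq> 0 \<Longrightarrow> b v v > 0"
begin

lemma linear_left: "linear (\<lambda>v. b v w)"
  using bilin by (simp add: bilinear_def)

lemma linear_right: "linear (b v)"
  using bilin by (simp add: bilinear_def)

lemmas left_simps = linear_add[OF linear_left] linear_diff[OF linear_left] linear_scale[OF linear_left]
  linear_0[OF linear_left] linear_neg[OF linear_left]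
lemmas right_simps = linear_add[OF linear_right] linear_diff[OF linear_right] linear_scale[OF linear_right]
  linear_0[OF linear_right] linear_neg[OF linear_right]

lemma sum_sum: "b (\<Sum>i\<in>I. f i) (\<Sum>j\<in>J. g j) = (\<Sum>i\<in>I. \<Sum>j\<in>J. b (f i) (g j))"
  unfolding linear_sum[OF linear_left, of f] by (simp add: linear_sum[OF linear_right])

lemma eq_0_iff: "b v v = 0 \<longleftrightarrow> v = 0"
  using pos[of v] left_simps(4) by fastforce

lemma projection_span_exists:
  assumes "finite B"
  shows "\<exists>v\<in>span B. \<forall>s\<in>span B. b (u - v) s = 0"
  using assms
proof (induction B arbitrary: u)
  case empty
  show ?case by (simp add: right_simps)
next
  case (insert x B)
  obtain vx where vx: "vx \<in> span B" "\<And>s. s \<in> span B \<Longrightarrow> b (x - vx) s = 0" using insert.IH by blast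
  obtain vu where vu: "vu \<in> span B" "\<And>s. s \<in> span B \<Longrightarrow> b (u - vu) s = 0" using insert.IH by blast
  define e where "e = x - vx"
  \<comment> \<open>The coefficient of \<open>u - vu\<close> along the new orthogonal direction
    \<open>e\<close>. If \<open>e = 0\<close>, division by zero makes \<open>k = 0\<close>, and
    orthogonality to \<open>e\<close> is trivial.\<close>
  define k where "k = b (u - vu) e / b e e"
  have k: "b (u - vu - k *\<^sub>R e) e = 0"
    unfolding k_def using eq_0_iff[of e] by (cases "e = 0") (simp_all add: left_simps(2-4) right_simps(4))
  have sB: "span B \<subseteq> span (insert x B)" by (rule span_mono) auto
  show ?case
  proof (intro bexI[of _ "vu + k *\<^sub>R e"] ballI)
    fix s assume "s \<in> span (insert x B)"
    then obtain t where t: "s - t *\<^sub>R x \<in> span B" using span_breakdown_eq by blast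
    \<comment> \<open>Replacing \<open>x\<close> by \<open>e + vx\<close> splits \<open>s\<close>
      into a multiple of \<open>e\<close> and an element of \<open>span B\<close>, on each of which
      orthogonality is already known.\<close>
    define s' where "s' = s - t *\<^sub>R x + t *\<^sub>R vx"
    have s': "s' \<in> span B" unfolding s'_def using t vx(1) by (intro span_add span_scale)
    have s: "s = t *\<^sub>R e + s'" by (simp add: s'_def e_def algebra_simps)
    have "b (u - vu - k *\<^sub>R e) s' = b (u - vu) s' - k * b e s'"
      by (simp only: left_simps real_scaleR_def)
    then have "b (u - vu - k *\<^sub>R e) s' = 0"
      using vu(2)[OF s'] vx(2)[OF s'] by (simp add: e_def)
    then have "b (u - vu - k *\<^sub>R e) (t *\<^sub>R e + s') = 0"
      using k by (simp only: right_simps) simp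
    then show "b (u - (vu + k *\<^sub>R e)) s = 0"
      unfolding s[symmetric] by (simp add: diff_diff_add)
  next
    have "x \<in> span (insert x B)" by (rule span_base) simp
    then show "vu + k *\<^sub>R e \<in> span (insert x B)"
      unfolding e_def using sB vu(1) vx(1) by (intro span_add span_scale span_diff) auto
  qed
qed

lemma projection_exists:
  assumes "subspace S"
  shows "\<exists>v\<in>S. \<forall>s\<in>S. b (u - v) s = 0"
proof -
  obtain B where B: "B \<subseteq> S" "independent B" "S \<subseteq> span B" by (rule basis_exists)
  have "span B = S" by (intro subset_antisym span_minimal B assms)
  with projection_span_exists[OF independent_imp_finite[OF B(2)], of u] show ?thesis by simp
qed

text \<open>Two candidates differ by an element of \<open>S\<close> orthogonal to itself, so
  positivity gives the uniqueness that the definite description requires.\<close>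

lemma orth_proj_eqI:
  assumes S: "subspace S" and v: "v \<in> S" "\<And>s. s \<in> S \<Longrightarrow> b (u - v) s = 0"
  shows "orth_proj b S u = v"
  unfolding orth_proj_def
proof (rule the_equality)
  fix w assume w: "w \<in> S \<and> (\<forall>s\<in>S. b (u - w) s = 0)"
  then have "w - v \<in> S" using S v(1) by (blast intro: subspace_diff)
  with v(2) w have "b (u - v) (w - v) = 0" "b (u - w) (w - v) = 0" by auto
  then have "b (w - v) (w - v) = 0" by (simp add: left_simps)
  then show "w = v" by (simp add: eq_0_iff)
qed (use v in auto)

lemma
  assumes "subspace S"
  shows orth_proj_in: "orth_proj b S u \<in> S"
    and orth_proj_orth: "s \<in> S \<Longrightarrow> b (u - orth_proj b S u) s = 0"
proof -
  obtain v where v: "v \<in> S" "\<And>s. s \<in> S \<Longrightarrow> b (u - v) s = 0"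
    using projection_exists[OF assms, of u] by blast
  have "orth_proj b S u = v" by (rule orth_proj_eqI[OF assms v])
  with v show "orth_proj b S u \<in> S" "s \<in> S \<Longrightarrow> b (u - orth_proj b S u) s = 0" by simp_all
qed

end

section \<open>Connections along a map\<close>

lemma connection_linear: "connection_along A B F D \<Longrightarrow> S \<in> sections_along A B F \<Longrightarrow> linear (\<lambda>u. D p u S)"
  by (simp add: connection_along_def)

lemma connection_add:
  "connection_along A B F D \<Longrightarrow> S \<in> sections_along A B F \<Longrightarrow> T \<in> sections_along A B F \<Longrightarrow>
    D p u (\<lambda>q. S q + T q) = D p u S + D p u T"
  by (simp add: connection_along_def)

lemma connection_zero:
  assumes "connection_along A B F D" "(\<lambda>_. 0) \<in> sections_along A B F"
  shows "D p u (\<lambda>_. 0) = 0"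
proof -
  have "D p u (\<lambda>q. 0 + 0) = D p u (\<lambda>_. 0) + D p u (\<lambda>_. 0)"
    by (rule connection_add[OF assms(1,2,2)])
  then show ?thesis by simp
qed

lemma connection_Leibniz:
  "connection_along A B F D \<Longrightarrow> f \<in> smooth_functions A \<Longrightarrow> S \<in> sections_along A B F \<Longrightarrow>
    D p u (\<lambda>q. f q *\<^sub>R S q) = dir_deriv A f p u *\<^sub>R S p + f p *\<^sub>R D p u S"
  by (simp add: connection_along_def)

lemma levi_civita_connection: "levi_civita A g nab \<Longrightarrow> connection_along A A id nab"
  by (simp add: levi_civita_def)

lemma levi_civita_metric:
  "levi_civita A g nab \<Longrightarrow> X \<in> vector_fields A \<Longrightarrow> Y \<in> vector_fields A \<Longrightarrow>
    dir_deriv A (\<lambda>q. g q (X q) (Y q)) p u = g p (nab p u X) (Y p) + g p (X p) (nab p u Y)"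
  by (simp add: levi_civita_def)

lemma levi_civita_bracket:
  "levi_civita A g nab \<Longrightarrow> X \<in> vector_fields A \<Longrightarrow> Y \<in> vector_fields A \<Longrightarrow> f \<in> smooth_functions A \<Longrightarrow>
    dir_deriv A f p (nab p (X p) Y - nab p (Y p) X) =
      dir_deriv A (\<lambda>q. dir_deriv A f q (Y q)) p (X p) - dir_deriv A (\<lambda>q. dir_deriv A f q (X q)) p (Y p)"
  by (simp add: levi_civita_def is_lie_bracket_def)

context
  fixes A :: "('a::{t2_space, second_countable_topology}, 'e::euclidean_space) chart set"
    and B :: "('b::{t2_space, second_countable_topology}, 'f::euclidean_space) chart set"
    and F :: "'a \<Rightarrow> 'b" and D :: "'a \<Rightarrow> 'e \<Rightarrow> ('a \<Rightarrow> 'f) \<Rightarrow> 'f"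
  assumes A: "smooth_manifold A" and B: "smooth_manifold B" and F: "continuous_on UNIV F"
    and D: "connection_along A B F D"
begin

lemma connection_sum:
  "(\<And>i. i \<in> J \<Longrightarrow> S i \<in> sections_along A B F) \<Longrightarrow> D p u (\<lambda>q. \<Sum>i\<in>J. S i q) = (\<Sum>i\<in>J. D p u (S i))"
  by (induction J rule: infinite_finite_induct)
     (simp_all add: connection_zero[OF D] sections_along_0[OF A B F] connection_add[OF D] sections_along_sum[OF A B F])

text \<open>Multiplication by a cutoff turns agreement near \<open>p\<close> into equality of global
  sections. In the Leibniz rule the terms with the derivative of \<open>\<eta>\<close> cancel, since
  \<open>S p = T p\<close>, and \<open>\<eta> p = 1\<close> leaves the claim.\<close>

lemma connection_local:
  assumes "S \<in> sections_along A B F" "T \<in> sections_along A B F"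
    and "open N" "p \<in> N" "\<And>q. q \<in> N \<Longrightarrow> S q = T q"
  shows "D p u S = D p u T"
proof -
  obtain \<eta> V C where \<eta>: "\<eta> \<in> smooth_functions A" "p \<in> V" "\<And>q. q \<in> V \<Longrightarrow> \<eta> q = 1"
    "C \<subseteq> N" "\<And>q. q \<notin> C \<Longrightarrow> \<eta> q = 0"
    using bump_function[OF A assms(3,4)] by metis
  have "(\<lambda>q. \<eta> q *\<^sub>R S q) = (\<lambda>q. \<eta> q *\<^sub>R T q)"
  proof
    show "\<eta> q *\<^sub>R S q = \<eta> q *\<^sub>R T q" for q
      using \<eta>(4) \<eta>(5)[of q] assms(5)[of q] by (cases "q \<in> C") auto
  qed
  then have "D p u (\<lambda>q. \<eta> q *\<^sub>R S q) = D p u (\<lambda>q. \<eta> q *\<^sub>R T q)" by simp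
  then show ?thesis
    using \<eta>(3)[OF \<eta>(2)] assms(4,5)
    by (simp add: connection_Leibniz[OF D \<eta>(1)] assms(1,2))
qed

end

text \<open>This is the symmetry of the Christoffel symbols. By torsion-freeness the difference of
  the two sides is a bracket; it annihilates every coordinate \<open>y c\<close>, because the
  derivatives of \<open>y c\<close> along frame fields are constant near \<open>q\<close>.\<close>

lemma frame_commute:
  assumes A: "smooth_manifold A" and L: "levi_civita A g nab" and fr: "frame_on A V Y y"
    and q: "q \<in> V" and ab: "a \<in> Basis" "b \<in> Basis"
  shows "nab q (Y a q) (Y b) = nab q (Y b q) (Y a)"
proof -
  have const: "dir_deriv A (\<lambda>q. dir_deriv A (y c) q (Y b q)) q v = 0" if "b \<in> Basis" "c \<in> Basis" for b c v
    using dir_deriv_cong[OF A smooth_functions_const[OF A] frame_onD(1)[OF fr] q,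
        of "if c = b then 1 else 0" "\<lambda>q. dir_deriv A (y c) q (Y b q)" v]
      frame_onD(5)[OF fr _ that(2,1)]
    by (simp add: dir_deriv_const[OF A])
  let ?Z = "nab q (Y a q) (Y b) - nab q (Y b q) (Y a)"
  have "dir_deriv A (y c) q ?Z = 0" if "c \<in> Basis" for c
    using levi_civita_bracket[OF L frame_onD(2,2,3)[OF fr], of c q a b] const ab that by simp
  then have "?Z = 0"
    using frame_onD(4)[OF fr q, of ?Z] by simp
  then show ?thesis by simp
qed

lemma riemannian_metric_inner_form: "riemannian_manifold A g \<Longrightarrow> inner_form (g p)"
  by (simp add: riemannian_manifold_def riemannian_metric_def inner_form_def)

lemma riemannian_metric_smooth:
  "riemannian_manifold A g \<Longrightarrow> X \<in> vector_fields A \<Longrightarrow> Y \<in> vector_fields A \<Longrightarrow>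
    (\<lambda>p. g p (X p) (Y p)) \<in> smooth_functions A"
  by (simp add: riemannian_manifold_def riemannian_metric_def)

section \<open>Smooth Riesz duality\<close>

context
  fixes A :: "('a::{t2_space, second_countable_topology}, 'e::euclidean_space) chart set"
    and g :: "'a \<Rightarrow> 'e \<Rightarrow> 'e \<Rightarrow> real"
  assumes Ag: "riemannian_manifold A g"
begin

text \<open>A Gram-Schmidt step on germs of fields: the only division is by \<open>g(e, e)\<close>, so smoothness of the
  Riesz dual does not require inverting the Gram matrix.\<close>

lemma frame_partial_Riesz:
  assumes fr: "frame_on A V Y y" "p \<in> V" and J: "finite J" "J \<subseteq> Basis"
    and "\<And>q. linear (\<phi> q)" "\<And>X. X \<in> vector_fields A \<Longrightarrow> (\<lambda>q. \<phi> q (X q)) \<in> smooth_functions A"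
  shows "\<exists>Z\<in>vector_fields A. \<exists>N. open N \<and> p \<in> N \<and>
    (\<forall>q\<in>N. Z q \<in> span ((\<lambda>a. Y a q) ` J) \<and> (\<forall>a\<in>J. g q (Z q) (Y a q) = \<phi> q (Y a q)))"
  using J assms(5,6)
proof (induction J arbitrary: \<phi>)
  case empty
  have A: "smooth_manifold A" using Ag by (simp add: riemannian_manifold_def)
  show ?case by (rule bexI[OF _ vector_fields_0[OF A]]) (auto intro: exI[of _ UNIV])
next
  case (insert j J)
  have A: "smooth_manifold A" using Ag by (simp add: riemannian_manifold_def)
  note Yv = frame_onD(2)[OF fr(1)]
  have J: "J \<subseteq> Basis" "j \<in> Basis" using insert.prems by auto
  interpret g: inner_form "g q" for q using riemannian_metric_inner_form[OF Ag] .
  \<comment> \<open>\<open>Zj\<close> is the projection of \<open>Y j\<close> to the span of the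
    earlier frame fields. It comes from the induction hypothesis for the form
    \<open>g q (Y j q)\<close>, which is why the induction varies \<open>\<phi>\<close>.\<close>
  obtain Zj N1 where Zj: "Zj \<in> vector_fields A" "open N1" "p \<in> N1"
    "\<And>q. q \<in> N1 \<Longrightarrow> Zj q \<in> span ((\<lambda>a. Y a q) ` J)"
    "\<And>q a. q \<in> N1 \<Longrightarrow> a \<in> J \<Longrightarrow> g q (Zj q) (Y a q) = g q (Y j q) (Y a q)"
    using insert.IH[of "\<lambda>q. g q (Y j q)", OF J(1) g.linear_right riemannian_metric_smooth[OF Ag Yv]] by metis
  obtain Z0 N0 where Z0: "Z0 \<in> vector_fields A" "open N0" "p \<in> N0"
    "\<And>q. q \<in> N0 \<Longrightarrow> Z0 q \<in> span ((\<lambda>a. Y a q) ` J)"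
    "\<And>q a. q \<in> N0 \<Longrightarrow> a \<in> J \<Longrightarrow> g q (Z0 q) (Y a q) = \<phi> q (Y a q)"
    using insert.IH[OF J(1) insert.prems(2,3)] by metis
  define e where "e q = Y j q - Zj q" for q
  have e: "e \<in> vector_fields A" unfolding e_def[abs_def] by (intro vector_fields_diff[OF A] Yv Zj)
  \<comment> \<open>Otherwise \<open>Y j p\<close> would be a combination of the other frame
    vectors, on all of which the derivative of \<open>y j\<close> vanishes, although it is
    \<open>1\<close> on \<open>Y j p\<close>.\<close>
  have "e p \<noteq> 0"
  proof
    assume "e p = 0"
    then have "Y j p \<in> span ((\<lambda>a. Y a p) ` J)" using Zj(3,4) by (simp add: e_def)
    then have "dir_deriv A (y j) p (Y j p) = 0"
    proof (rule linear_eq_0_on_span[OF linear_dir_deriv[OF A frame_onD(3)[OF fr(1)]], rotated])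
      fix x assume "x \<in> (\<lambda>a. Y a p) ` J"
      then show "dir_deriv A (y j) p x = 0"
        using insert.hyps(2) J frame_onD(5)[OF fr(1,2) J(2)] by (auto simp: subset_iff)
    qed
    then show False using frame_onD(5)[OF fr(1,2) J(2,2)] by simp
  qed
  then obtain r N2 where r: "r \<in> smooth_functions A" "open N2" "p \<in> N2" "\<And>q. q \<in> N2 \<Longrightarrow> r q * g q (e q) (e q) = 1"
    using reciprocal_near[OF A riemannian_metric_smooth[OF Ag e e], of p] g.eq_0_iff g.pos
    by (metis less_eq_real_def)
  \<comment> \<open>Chosen so that \<open>Z = Z0 + k e\<close> represents \<open>\<phi>\<close> on
    \<open>e\<close> near \<open>p\<close>. As \<open>e\<close> is orthogonal there to the earlier
    frame fields, the equations already solved by \<open>Z0\<close> survive.\<close>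
  define k where "k q = r q * (\<phi> q (e q) - g q (Z0 q) (e q))" for q
  have k: "k \<in> smooth_functions A" unfolding k_def[abs_def]
    by (intro smooth_functions_mult[OF A] smooth_functions_diff[OF A] r insert.prems(3) e riemannian_metric_smooth[OF Ag] Z0)
  define Z where "Z q = Z0 q + k q *\<^sub>R e q" for q
  have "Z \<in> vector_fields A" unfolding Z_def[abs_def]
    by (intro vector_fields_add[OF A] vector_fields_scale[OF A] Z0 k e)
  moreover have "Z q \<in> span ((\<lambda>a. Y a q) ` insert j J) \<and> (\<forall>a\<in>insert j J. g q (Z q) (Y a q) = \<phi> q (Y a q))"
    if q: "q \<in> N0 \<inter> N1 \<inter> N2" for q
  proof -
    have q': "q \<in> N0" "q \<in> N1" "q \<in> N2" using q by auto
    have sJ: "span ((\<lambda>a. Y a q) ` J) \<subseteq> span ((\<lambda>a. Y a q) ` insert j J)" by (rule span_mono) auto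
    have sj: "Y j q \<in> span ((\<lambda>a. Y a q) ` insert j J)" by (rule span_base) simp
    have 1: "Z q \<in> span ((\<lambda>a. Y a q) ` insert j J)"
      unfolding Z_def e_def using Z0(4)[OF q'(1)] Zj(4)[OF q'(2)] sJ sj
      by (intro span_add span_scale span_diff) auto
    have 2: "g q (Z q) (Y a q) = \<phi> q (Y a q)" if "a \<in> J" for a
      using Z0(5)[OF q'(1) that] Zj(5)[OF q'(2) that] by (simp add: Z_def e_def g.left_simps)
    note lin = insert.prems(2)[of q]
    \<comment> \<open>Linearity extends the earlier equations to their span, which contains
      \<open>Zj\<close>. With \<open>Y j = e + Zj\<close> the equation for \<open>j\<close>
      follows.\<close>
    have "g q (Z q) (Zj q) - \<phi> q (Zj q) = 0"
      by (rule linear_eq_0_on_span[OF linear_compose_sub[OF g.linear_right lin] _ Zj(4)[OF q'(2)]]) (auto simp: 2)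
    moreover have "g q (Z q) (e q) = \<phi> q (e q)"
    proof -
      have "k q * g q (e q) (e q) = (r q * g q (e q) (e q)) * (\<phi> q (e q) - g q (Z0 q) (e q))"
        by (simp add: k_def)
      then show ?thesis using r(4)[OF q'(3)] by (simp add: Z_def g.left_simps)
    qed
    ultimately have "g q (Z q) (Y j q) = \<phi> q (Y j q)"
      by (simp add: e_def g.right_simps linear_diff[OF lin])
    with 1 2 show ?thesis by blast
  qed
  moreover have "open (N0 \<inter> N1 \<inter> N2)" "p \<in> N0 \<inter> N1 \<inter> N2" using Zj Z0 r by auto
  ultimately show ?case by blast
qed

text \<open>The dual vector is unique at each point, so the local smooth solutions agree with one
  global choice and need no partition of unity to be glued.\<close>

lemma Riesz_field:
  assumes "\<And>q. linear (\<phi> q)" "\<And>X. X \<in> vector_fields A \<Longrightarrow> (\<lambda>q. \<phi> q (X q)) \<in> smooth_functions A"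
  shows "\<exists>Z\<in>vector_fields A. \<forall>q s. g q (Z q) s = \<phi> q s"
proof -
  have A: "smooth_manifold A" using Ag by (simp add: riemannian_manifold_def)
  interpret g: inner_form "g q" for q using riemannian_metric_inner_form[OF Ag] .
  have loc: "\<exists>N Z. open N \<and> p \<in> N \<and> Z \<in> vector_fields A \<and> (\<forall>q\<in>N. \<forall>s. g q (Z q) s = \<phi> q s)" for p
  proof -
    obtain V Y y where fr: "p \<in> V" "frame_on A V Y y"
      using local_frame[OF A] by metis
    obtain Z N where Z: "Z \<in> vector_fields A" "open N" "p \<in> N" "\<And>q a. q \<in> N \<Longrightarrow> a \<in> Basis \<Longrightarrow> g q (Z q) (Y a q) = \<phi> q (Y a q)"
      using frame_partial_Riesz[OF fr(2,1) finite_Basis subset_refl assms] by metis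
    have "g q (Z q) s = \<phi> q s" if q: "q \<in> N \<inter> V" for q s
    proof -
      have "g q (Z q) (\<Sum>a\<in>Basis. dir_deriv A (y a) q s *\<^sub>R Y a q) = \<phi> q (\<Sum>a\<in>Basis. dir_deriv A (y a) q s *\<^sub>R Y a q)"
        using Z(4) q by (simp add: linear_sum[OF g.linear_right] linear_sum[OF assms(1)] g.right_simps linear_scale[OF assms(1)])
      then show ?thesis using frame_onD(4)[OF fr(2)] q by simp
    qed
    moreover have "open (N \<inter> V)" using Z(2) frame_onD(1)[OF fr(2)] by blast
    ultimately show ?thesis using fr(1) Z(1,3) by blast
  qed
  define Z where "Z q = (SOME z. \<forall>s. g q z s = \<phi> q s)" for q
  have Z: "g q (Z q) s = \<phi> q s" for q s
  proof -
    have "\<exists>z. \<forall>s. g q z s = \<phi> q s" using loc[of q] by blast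
    then have "\<forall>s. g q (Z q) s = \<phi> q s" unfolding Z_def by (rule someI_ex)
    then show ?thesis by blast
  qed
  have uniq: "z = Z q" if "\<And>s. g q z s = \<phi> q s" for q z
    using that[of "z - Z q"] Z[of q "z - Z q"] g.eq_0_iff[of q "z - Z q"] by (simp add: g.left_simps)
  have "Z \<in> vector_fields A"
  proof (rule vector_fields_local[OF A])
    fix p show "\<exists>N T. open N \<and> p \<in> N \<and> T \<in> vector_fields A \<and> (\<forall>q\<in>N. Z q = T q)"
      using loc[of p] uniq by metis
  qed
  then show ?thesis using Z by blast
qed

end

section \<open>Riemannian submersions\<close>

locale submersion =
  fixes AM :: "('a::{t2_space, second_countable_topology}, 'e::euclidean_space) chart set"
    and AN :: "('b::{t2_space, second_countable_topology}, 'f::euclidean_space) chart set"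
    and gM :: "'a \<Rightarrow> 'e \<Rightarrow> 'e \<Rightarrow> real" and gN :: "'b \<Rightarrow> 'f \<Rightarrow> 'f \<Rightarrow> real"
    and nabM :: "'a \<Rightarrow> 'e \<Rightarrow> ('a \<Rightarrow> 'e) \<Rightarrow> 'e" and nabN :: "'b \<Rightarrow> 'f \<Rightarrow> ('b \<Rightarrow> 'f) \<Rightarrow> 'f"
    and F :: "'a \<Rightarrow> 'b" and nabF :: "'a \<Rightarrow> 'e \<Rightarrow> ('a \<Rightarrow> 'f) \<Rightarrow> 'f"
  assumes M: "riemannian_manifold AM gM" and LM: "levi_civita AM gM nabM"
    and N: "riemannian_manifold AN gN" and LN: "levi_civita AN gN nabN"
    and sub: "riemannian_submersion AM gM AN gN F"
    and pullback: "pullback_connection AM AN F nabN nabF"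
begin

abbreviation "dF \<equiv> differential AM AN F"
abbreviation "Ver \<equiv> vertical_space AM AN F"
abbreviation "Hor \<equiv> horizontal_space AM gM AN F"
abbreviation "\<V> \<equiv> vert AM gM AN F"
abbreviation "\<H> \<equiv> horiz AM gM AN F"
abbreviation "sff \<equiv> second_fundamental_form AM AN F nabM nabF"

lemma AM: "smooth_manifold AM" and AN: "smooth_manifold AN"
  using M N by (auto simp: riemannian_manifold_def)

lemma F: "smooth_map AM AN F"
  using sub by (simp add: riemannian_submersion_def)

lemmas F_continuous = smooth_map_continuous[OF AM AN F]

lemma nabF: "connection_along AM AN F nabF"
  and nabF_pullback: "Y \<in> vector_fields AN \<Longrightarrow> nabF p u (\<lambda>q. Y (F q)) = nabN (F p) (dF p u) Y"
  using pullback by (auto simp: pullback_connection_def)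

sublocale gM: inner_form "gM p" for p
  by (rule riemannian_metric_inner_form[OF M])

sublocale gN: inner_form "gN p" for p
  by (rule riemannian_metric_inner_form[OF N])

lemmas linear_dF = linear_differential[OF AM AN F]

lemma linear_nabM: "X \<in> vector_fields AM \<Longrightarrow> linear (\<lambda>u. nabM p u X)"
  using connection_linear[OF levi_civita_connection[OF LM]] by (simp add: vector_fields_def)

lemma nabM_add:
  "X \<in> vector_fields AM \<Longrightarrow> Y \<in> vector_fields AM \<Longrightarrow> nabM p u (\<lambda>q. X q + Y q) = nabM p u X + nabM p u Y"
  using connection_add[OF levi_civita_connection[OF LM]] by (simp add: vector_fields_def)

lemma nabM_0: "nabM p u (\<lambda>_. 0) = 0"
  using connection_zero[OF levi_civita_connection[OF LM]] vector_fields_0[OF AM] by (simp add: vector_fields_def)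

lemma nabF_0: "nabF p u (\<lambda>_. 0) = 0"
  by (rule connection_zero[OF nabF sections_along_0[OF AM AN F_continuous]])

lemmas dF_section = differential_section[OF AM AN F]

section \<open>The second fundamental form in a pulled-back frame\<close>

text \<open>\<open>dF W\<close> need not be the pullback of a field on the target, so
  \<open>nabF\<close> cannot be read off directly. Near \<open>p\<close> it is a combination of
  pulled-back frame fields, to which locality and the Leibniz rule apply.\<close>

lemma nabF_dF_in_frame:
  assumes fr: "frame_on AN V Y y" "F p \<in> V" and W: "W \<in> vector_fields AM"
  defines "w \<equiv> \<lambda>a q. dir_deriv AM (\<lambda>q. y a (F q)) q (W q)"
  shows "nabF p u (\<lambda>q. dF q (W q)) =
    (\<Sum>a\<in>Basis. dir_deriv AM (w a) p u *\<^sub>R Y a (F p) + w a p *\<^sub>R nabN (F p) (dF p u) (Y a))"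
proof -
  note y = frame_onD(3)[OF fr(1)] and Y = frame_onD(2)[OF fr(1)]
  have w: "w a \<in> smooth_functions AM" for a
    unfolding w_def by (rule dir_deriv_smooth[OF AM smooth_functions_compose[OF AM AN F y] W])
  have s: "(\<lambda>q. w a q *\<^sub>R Y a (F q)) \<in> sections_along AM AN F" for a
    by (rule sections_along_scale[OF AM AN F_continuous w pullback_field_section[OF AM AN F Y]])
  have "nabF p u (\<lambda>q. dF q (W q)) = nabF p u (\<lambda>q. \<Sum>a\<in>Basis. w a q *\<^sub>R Y a (F q))"
  proof (rule connection_local[OF AM AN F_continuous nabF dF_section[OF W]])
    show "(\<lambda>q. \<Sum>a\<in>Basis. w a q *\<^sub>R Y a (F q)) \<in> sections_along AM AN F"
      by (rule sections_along_sum[OF AM AN F_continuous s])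
    show "open (F -` V)" by (rule open_vimage[OF frame_onD(1)[OF fr(1)] F_continuous])
    show "p \<in> F -` V" using fr(2) by simp
    show "dF q (W q) = (\<Sum>a\<in>Basis. w a q *\<^sub>R Y a (F q))" if "q \<in> F -` V" for q
      unfolding w_def using that by (intro differential_in_frame[OF AM AN F fr(1)]) simp
  qed
  also have "\<dots> = (\<Sum>a\<in>Basis. nabF p u (\<lambda>q. w a q *\<^sub>R Y a (F q)))"
    by (rule connection_sum[OF AM AN F_continuous nabF s])
  also have "\<dots> = (\<Sum>a\<in>Basis. dir_deriv AM (w a) p u *\<^sub>R Y a (F p) + w a p *\<^sub>R nabN (F p) (dF p u) (Y a))"
    by (simp add: connection_Leibniz[OF nabF w pullback_field_section[OF AM AN F Y]] nabF_pullback[OF Y])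
  finally show ?thesis .
qed

lemma sff_symmetric:
  assumes U: "U \<in> vector_fields AM" and W: "W \<in> vector_fields AM"
  shows "sff U W p = sff W U p"
proof -
  obtain V Y y where fr: "F p \<in> V" "frame_on AN V Y y"
    using local_frame[OF AN] by metis
  let ?f = "\<lambda>a q. y a (F q)"
  let ?w = "\<lambda>W a q. dir_deriv AM (?f a) q (W q)"
  let ?Z = "nabM p (U p) W - nabM p (W p) U"
  let ?n = "\<lambda>a b. nabN (F p) (Y a (F p)) (Y b)"
  have f: "?f a \<in> smooth_functions AM" for a
    by (rule smooth_functions_compose[OF AM AN F frame_onD(3)[OF fr(2)]])
  have dFrep: "dF p v = (\<Sum>a\<in>Basis. dir_deriv AM (?f a) p v *\<^sub>R Y a (F p))" for v
    by (rule differential_in_frame[OF AM AN F fr(2,1)])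
  \<comment> \<open>Torsion-freeness on the source: each component of \<open>dF ?Z\<close> is the
    derivative of a pulled-back coordinate along a bracket, hence a difference of iterated
    derivatives.\<close>
  have bracket: "dF p ?Z = (\<Sum>a\<in>Basis. dir_deriv AM (?w W a) p (U p) *\<^sub>R Y a (F p))
      - (\<Sum>a\<in>Basis. dir_deriv AM (?w U a) p (W p) *\<^sub>R Y a (F p))"
    unfolding dFrep levi_civita_bracket[OF LM U W f] by (simp add: algebra_simps sum_subtractf)
  have nab: "nabN (F p) (dF p u) (Y a) = (\<Sum>b\<in>Basis. dir_deriv AM (?f b) p u *\<^sub>R ?n b a)" for u a
  proof -
    have "Y a \<in> sections_along AN AN id"
      using frame_onD(2)[OF fr(2)] by (simp add: vector_fields_def)
    note lin = connection_linear[OF levi_civita_connection[OF LN] this]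
    show ?thesis unfolding dFrep by (simp add: linear_sum[OF lin] linear_scale[OF lin])
  qed
  \<comment> \<open>Torsion-freeness on the target: after renaming the summation indices,
    \<open>frame_commute\<close> exchanges the roles of \<open>U\<close> and
    \<open>W\<close>.\<close>
  have "(\<Sum>a\<in>Basis. ?w W a p *\<^sub>R nabN (F p) (dF p (U p)) (Y a))
      = (\<Sum>a\<in>Basis. \<Sum>b\<in>Basis. (?w W a p * ?w U b p) *\<^sub>R ?n b a)"
    by (simp add: nab scaleR_sum_right)
  also have "\<dots> = (\<Sum>b\<in>Basis. \<Sum>a\<in>Basis. (?w W a p * ?w U b p) *\<^sub>R ?n b a)"
    by (rule sum.swap)
  also have "\<dots> = (\<Sum>b\<in>Basis. \<Sum>a\<in>Basis. (?w U b p * ?w W a p) *\<^sub>R ?n a b)"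
    by (intro sum.cong refl) (simp add: frame_commute[OF AN LN fr(2,1)] mult.commute)
  also have "\<dots> = (\<Sum>a\<in>Basis. ?w U a p *\<^sub>R nabN (F p) (dF p (W p)) (Y a))"
    by (simp add: nab scaleR_sum_right)
  finally have nn: "(\<Sum>a\<in>Basis. ?w W a p *\<^sub>R nabN (F p) (dF p (U p)) (Y a))
      = (\<Sum>a\<in>Basis. ?w U a p *\<^sub>R nabN (F p) (dF p (W p)) (Y a))" .
  have "nabF p (U p) (\<lambda>q. dF q (W q)) - nabF p (W p) (\<lambda>q. dF q (U q)) = dF p ?Z"
    unfolding nabF_dF_in_frame[OF fr(2,1) W] nabF_dF_in_frame[OF fr(2,1) U] bracket sum.distrib nn by simp
  then show ?thesis
    by (simp add: second_fundamental_form_def linear_diff[OF linear_dF] algebra_simps)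
qed

lemma frame_component_smooth:
  assumes "frame_on AN V Y y" "W \<in> vector_fields AM"
  shows "(\<lambda>q. dir_deriv AM (\<lambda>q. y a (F q)) q (W q)) \<in> smooth_functions AM"
  by (rule dir_deriv_smooth[OF AM smooth_functions_compose[OF AM AN F frame_onD(3)[OF assms(1)]] assms(2)])

lemma frame_gram_smooth:
  assumes "frame_on AN V Y y"
  shows "(\<lambda>q. gN (F q) (Y a (F q)) (Y b (F q))) \<in> smooth_functions AM"
  by (rule smooth_functions_compose[OF AM AN F riemannian_metric_smooth[OF N frame_onD(2,2)[OF assms]]])

lemma gN_dF_in_frame:
  assumes "frame_on AN V Y y" "F q \<in> V"
  shows "gN (F q) (dF q u) (dF q v) = (\<Sum>a\<in>Basis. \<Sum>b\<in>Basis.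
    (dir_deriv AM (\<lambda>q. y a (F q)) q u * dir_deriv AM (\<lambda>q. y b (F q)) q v) * gN (F q) (Y a (F q)) (Y b (F q)))"
  unfolding differential_in_frame[OF AM AN F assms]
  by (simp add: gN.sum_sum gN.left_simps gN.right_simps mult_ac)

lemma gN_dF_smooth:
  assumes W: "W \<in> vector_fields AM" and Z: "Z \<in> vector_fields AM"
  shows "(\<lambda>q. gN (F q) (dF q (W q)) (dF q (Z q))) \<in> smooth_functions AM" (is "?G \<in> _")
proof (rule smooth_functions_local[OF AM])
  fix p
  obtain V Y y where fr: "F p \<in> V" "frame_on AN V Y y"
    using local_frame[OF AN] by metis
  let ?H = "\<lambda>q. \<Sum>a\<in>Basis. \<Sum>b\<in>Basis. (dir_deriv AM (\<lambda>q. y a (F q)) q (W q)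
    * dir_deriv AM (\<lambda>q. y b (F q)) q (Z q)) * gN (F q) (Y a (F q)) (Y b (F q))"
  have "?H \<in> smooth_functions AM"
    by (intro smooth_functions_sum[OF AM] smooth_functions_mult[OF AM] frame_component_smooth[OF fr(2)]
        frame_gram_smooth[OF fr(2)] W Z)
  moreover have "\<forall>q\<in>F -` V. ?G q = ?H q"
    using gN_dF_in_frame[OF fr(2)] by simp
  moreover have "open (F -` V)" by (rule open_vimage[OF frame_onD(1)[OF fr(2)] F_continuous])
  ultimately show "\<exists>N g. open N \<and> p \<in> N \<and> g \<in> smooth_functions AM \<and> (\<forall>q\<in>N. ?G q = g q)"
    using fr(1) by blast
qed

text \<open>Metric compatibility is not part of the description of \<open>nabF\<close>. The chain
  rule transfers that of \<open>nabN\<close> to the Gram functions of the pulled-back frame, and the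
  product rule does the rest.\<close>

lemma nabF_dF_metric:
  assumes W: "W \<in> vector_fields AM" and Z: "Z \<in> vector_fields AM"
  shows "dir_deriv AM (\<lambda>q. gN (F q) (dF q (W q)) (dF q (Z q))) p u =
      gN (F p) (nabF p u (\<lambda>q. dF q (W q))) (dF p (Z p)) + gN (F p) (dF p (W p)) (nabF p u (\<lambda>q. dF q (Z q)))"
proof -
  let ?G = "\<lambda>q. gN (F q) (dF q (W q)) (dF q (Z q))"
  obtain V Y y where fr: "F p \<in> V" "frame_on AN V Y y"
    using local_frame[OF AN] by metis
  define w where "w a q = dir_deriv AM (\<lambda>q. y a (F q)) q (W q)" for a q
  define z where "z a q = dir_deriv AM (\<lambda>q. y a (F q)) q (Z q)" for a q
  define h where "h a b q = gN (F q) (Y a (F q)) (Y b (F q))" for a b q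
  have wzh: "w a \<in> smooth_functions AM" "z a \<in> smooth_functions AM" "h a b \<in> smooth_functions AM" for a b
    unfolding w_def[abs_def] z_def[abs_def] h_def[abs_def]
    by (intro frame_component_smooth[OF fr(2)] frame_gram_smooth[OF fr(2)] W Z)+
  let ?H = "\<lambda>q. \<Sum>a\<in>Basis. \<Sum>b\<in>Basis. (w a q * z b q) * h a b q"
  have H: "?H \<in> smooth_functions AM"
    by (intro smooth_functions_sum[OF AM] smooth_functions_mult[OF AM] wzh)
  have HG: "?H q = ?G q" if "q \<in> F -` V" for q
    unfolding w_def z_def h_def using that by (intro gN_dF_in_frame[OF fr(2), symmetric]) simp
  note Y = frame_onD(2)[OF fr(2)]
  let ?n = "\<lambda>a. nabN (F p) (dF p u) (Y a)"
  have dh: "dir_deriv AM (h a b) p u = gN (F p) (?n a) (Y b (F p)) + gN (F p) (Y a (F p)) (?n b)" for a b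
    unfolding h_def[abs_def]
    using dir_deriv_compose[OF AM AN F riemannian_metric_smooth[OF N Y Y], of a b p u]
      levi_civita_metric[OF LN Y Y] by simp
  have "dir_deriv AM ?G p u = dir_deriv AM ?H p u"
    by (rule dir_deriv_cong[OF AM H open_vimage[OF frame_onD(1)[OF fr(2)] F_continuous] _ HG])
       (use fr in auto)
  also have "\<dots> = (\<Sum>a\<in>Basis. \<Sum>b\<in>Basis. (w a p * z b p) * dir_deriv AM (h a b) p u
      + (w a p * dir_deriv AM (z b) p u + dir_deriv AM (w a) p u * z b p) * h a b p)"
    by (simp add: dir_deriv_sum[OF AM] dir_deriv_mult[OF AM] smooth_functions_sum[OF AM]
        smooth_functions_mult[OF AM] wzh)
  also have "\<dots> = gN (F p) (\<Sum>a\<in>Basis. dir_deriv AM (w a) p u *\<^sub>R Y a (F p) + w a p *\<^sub>R ?n a) (\<Sum>b\<in>Basis. z b p *\<^sub>R Y b (F p))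
      + gN (F p) (\<Sum>a\<in>Basis. w a p *\<^sub>R Y a (F p)) (\<Sum>b\<in>Basis. dir_deriv AM (z b) p u *\<^sub>R Y b (F p) + z b p *\<^sub>R ?n b)"
    unfolding dh gN.sum_sum sum.distrib[symmetric]
    by (intro sum.cong refl) (simp add: gN.left_simps gN.right_simps h_def algebra_simps)
  also have "\<dots> = gN (F p) (nabF p u (\<lambda>q. dF q (W q))) (dF p (Z p)) + gN (F p) (dF p (W p)) (nabF p u (\<lambda>q. dF q (Z q)))"
    unfolding nabF_dF_in_frame[OF fr(2,1) W] nabF_dF_in_frame[OF fr(2,1) Z] differential_in_frame[OF AM AN F fr(2,1)]
      w_def z_def ..
  finally show "dir_deriv AM ?G p u =
      gN (F p) (nabF p u (\<lambda>q. dF q (W q))) (dF p (Z p)) + gN (F p) (dF p (W p)) (nabF p u (\<lambda>q. dF q (Z q)))" .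
qed

section \<open>The vertical and horizontal splitting\<close>

lemma subspace_Ver: "subspace (Ver p)"
  unfolding vertical_space_def subspace_def
  by (auto simp: linear_0[OF linear_dF] linear_add[OF linear_dF] linear_scale[OF linear_dF])

lemma subspace_Hor: "subspace (Hor p)"
  unfolding horizontal_space_def subspace_def by (auto simp: gM.left_simps)

lemma Hor_Ver_orth: "x \<in> Hor p \<Longrightarrow> v \<in> Ver p \<Longrightarrow> gM p x v = 0"
  by (auto simp: horizontal_space_def)

lemma Ver_Hor_orth: "v \<in> Ver p \<Longrightarrow> x \<in> Hor p \<Longrightarrow> gM p v x = 0"
  using Hor_Ver_orth gM.sym by metis

lemma vert_in: "\<V> p u \<in> Ver p"
  unfolding vert_def by (rule gM.orth_proj_in[OF subspace_Ver])

lemma horiz_eq: "\<H> p u = u - \<V> p u"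
proof -
  have "u - \<V> p u \<in> Hor p"
    unfolding horizontal_space_def vert_def using gM.orth_proj_orth[OF subspace_Ver] by blast
  then show ?thesis
    unfolding horiz_def[of AM gM AN F p]
    by (rule gM.orth_proj_eqI[OF subspace_Hor]) (simp add: Ver_Hor_orth[OF vert_in])
qed

lemma horiz_in: "\<H> p u \<in> Hor p"
  unfolding horiz_def by (rule gM.orth_proj_in[OF subspace_Hor])

lemma horiz_Hor: "x \<in> Hor p \<Longrightarrow> \<H> p x = x"
  unfolding horiz_def by (rule gM.orth_proj_eqI[OF subspace_Hor]) (simp_all add: gM.left_simps)

lemma vert_Ver: "v \<in> Ver p \<Longrightarrow> \<V> p v = v"
  unfolding vert_def by (rule gM.orth_proj_eqI[OF subspace_Ver]) (simp_all add: gM.left_simps)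

lemma vert_Hor: "x \<in> Hor p \<Longrightarrow> \<V> p x = 0"
  using horiz_eq[of p x] horiz_Hor by simp

lemma dF_Ver: "v \<in> Ver p \<longleftrightarrow> dF p v = 0"
  by (simp add: vertical_space_def)

lemma dF_horiz: "dF p (\<H> p u) = dF p u"
  using vert_in[of p u] by (simp add: horiz_eq linear_diff[OF linear_dF] dF_Ver)

text \<open>The submersion is isometric on pairs of horizontal vectors. One horizontal argument is
  enough, because the vertical part of \<open>u\<close> is orthogonal to \<open>x\<close> and killed
  by \<open>dF\<close>.\<close>

lemma gM_Hor: "x \<in> Hor p \<Longrightarrow> gM p u x = gN (F p) (dF p u) (dF p x)"
proof -
  assume x: "x \<in> Hor p"
  have "gM p u x = gM p (\<H> p u) x"
    by (simp add: horiz_eq gM.left_simps Ver_Hor_orth[OF vert_in x])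
  also have "\<dots> = gN (F p) (dF p (\<H> p u)) (dF p x)"
    using sub x horiz_in unfolding riemannian_submersion_def by metis
  finally show ?thesis by (simp add: dF_horiz)
qed

text \<open>Since \<open>dF\<close> is a partial isometry with kernel \<open>Ver\<close>, its adjoint satisfies
  \<open>dF\<^sup>* dF = \<H>\<close>; thus \<open>\<H> W\<close> is the Riesz dual of the smooth form \<open>gN (dF W) (dF \<cdot>)\<close>.\<close>

lemma horiz_field:
  assumes W: "W \<in> vector_fields AM"
  shows "(\<lambda>q. \<H> q (W q)) \<in> vector_fields AM"
proof -
  let ?\<phi> = "\<lambda>q s. gN (F q) (dF q (W q)) (dF q s)"
  have lin: "linear (?\<phi> q)" for q
    using linear_compose[OF linear_dF gN.linear_right] by (simp add: o_def)
  obtain Z where Z: "Z \<in> vector_fields AM" "\<And>q s. gM q (Z q) s = ?\<phi> q s"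
    using Riesz_field[OF M lin gN_dF_smooth[OF W]] by blast
  have "gM q (Z q - \<H> q (W q)) s = 0" for q s
  proof -
    have "gM q (\<H> q (W q)) s = gN (F q) (dF q s) (dF q (W q))"
      using gM_Hor[OF horiz_in] by (metis gM.sym dF_horiz)
    then show ?thesis using Z(2)[of q s] gN.sym[of "F q"] by (simp add: gM.left_simps)
  qed
  then have "Z q - \<H> q (W q) = 0" for q using gM.eq_0_iff by blast
  then have "(\<lambda>q. \<H> q (W q)) = Z" by (auto simp: fun_eq_iff)
  then show ?thesis using Z(1) by simp
qed

lemma vert_field:
  assumes W: "W \<in> vector_fields AM"
  shows "(\<lambda>q. \<V> q (W q)) \<in> vector_fields AM"
  using vector_fields_diff[OF AM W horiz_field[OF W]] by (simp add: horiz_eq)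

lemma sff_horizontal:
  assumes X: "X \<in> horizontal_fields AM gM AN F" and Y: "Y \<in> horizontal_fields AM gM AN F"
  shows "sff X Y p = 0"
proof -
  let ?B = "\<lambda>X Y Z. gN (F p) (sff X Y p) (dF p (Z p))"
  have fields: "X \<in> vector_fields AM" "X q \<in> Hor q" if "X \<in> horizontal_fields AM gM AN F" for X q
    using that by (auto simp: horizontal_fields_def)
  have skew: "?B X Y Z = - ?B X Z Y"
    if Y: "Y \<in> horizontal_fields AM gM AN F" and Z: "Z \<in> horizontal_fields AM gM AN F" for X Y Z
  proof -
    \<comment> \<open>For horizontal \<open>Y\<close>, \<open>Z\<close> the function
      \<open>gM (Y, Z)\<close> equals \<open>gN (dF Y, dF Z)\<close>. Differentiating it with both
      metric connections and comparing leaves only second fundamental forms.\<close>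
    have "gM p (nabM p (X p) Y) (Z p) + gM p (Y p) (nabM p (X p) Z) = dir_deriv AM (\<lambda>q. gM q (Y q) (Z q)) p (X p)"
      using levi_civita_metric[OF LM fields(1)[OF Y] fields(1)[OF Z]] by simp
    also have "\<dots> = dir_deriv AM (\<lambda>q. gN (F q) (dF q (Y q)) (dF q (Z q))) p (X p)"
      by (simp add: gM_Hor[OF fields(2)[OF Z]])
    also have "\<dots> = gN (F p) (nabF p (X p) (\<lambda>q. dF q (Y q))) (dF p (Z p))
        + gN (F p) (nabF p (X p) (\<lambda>q. dF q (Z q))) (dF p (Y p))"
      using nabF_dF_metric[OF fields(1)[OF Y] fields(1)[OF Z]] gN.sym[of "F p" "dF p (Y p)"] by simp
    finally show ?thesis
      using gM_Hor[OF fields(2)[OF Z]] gM_Hor[OF fields(2)[OF Y]] gM.sym[of p "Y p"]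
      by (simp add: second_fundamental_form_def gN.left_simps)
  qed
  have sym: "?B X Y Z = ?B Y X Z"
    if "X \<in> horizontal_fields AM gM AN F" "Y \<in> horizontal_fields AM gM AN F" for X Y Z
    using sff_symmetric[OF fields(1)[OF that(1)] fields(1)[OF that(2)]] by simp
  \<comment> \<open>Alternating the two relations three times permutes the arguments back to
    \<open>X Y Z\<close> with the sign reversed, so the value is its own negative.\<close>
  have z: "?B X Y Z = 0" if Z: "Z \<in> horizontal_fields AM gM AN F" for Z
    using skew[OF Y Z, of X] skew[OF X Z, of Y] skew[OF X Y, of Z] sym[OF X Y, of Z] sym[OF X Z, of Y] sym[OF Y Z, of X]
    by linarith
  \<comment> \<open>The value of the form is tested against itself: it is \<open>dF p v\<close> for
    some \<open>v\<close>, and taking the horizontal part of a field through \<open>v\<close> does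
    not change that image.\<close>
  obtain v where v: "dF p v = sff X Y p"
    using sub unfolding riemannian_submersion_def surj_def by metis
  obtain Z where Z: "Z \<in> vector_fields AM" "Z p = v"
    using extend_tangent_vector[OF AM] by metis
  have "(\<lambda>q. \<H> q (Z q)) \<in> horizontal_fields AM gM AN F"
    using horiz_field[OF Z(1)] horiz_in by (simp add: horizontal_fields_def)
  from z[OF this] have "gN (F p) (sff X Y p) (sff X Y p) = 0"
    by (simp add: dF_horiz Z v)
  then show ?thesis by (simp add: gN.eq_0_iff)
qed

lemma sff_add:
  assumes "W \<in> vector_fields AM" "W' \<in> vector_fields AM"
  shows "sff U (\<lambda>q. W q + W' q) p = sff U W p + sff U W' p"
  using connection_add[OF nabF dF_section[OF assms(1)] dF_section[OF assms(2)], of p "U p"]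
  by (simp add: second_fundamental_form_def nabM_add[OF assms] linear_add[OF linear_dF])

lemma sff_vertical:
  assumes "V \<in> vertical_fields AM AN F"
  shows "sff U V p = - dF p (nabM p (U p) V)"
proof -
  have "(\<lambda>q. dF q (V q)) = (\<lambda>_. 0)"
    using assms by (auto simp: vertical_fields_def dF_Ver)
  then show ?thesis by (simp add: second_fundamental_form_def nabF_0)
qed

section \<open>Total geodesy as verticality of derivatives of vertical fields\<close>

lemma totally_geodesic_iff:
  "totally_geodesic_map AM AN F nabM nabF \<longleftrightarrow>
    (\<forall>V\<in>vertical_fields AM AN F. \<forall>W\<in>vertical_fields AM AN F. \<forall>X\<in>horizontal_fields AM gM AN F. \<forall>p.
       nabM p (X p) V \<in> Ver p \<and> nabM p (V p) W \<in> Ver p)" (is "?L \<longleftrightarrow> ?R")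
proof
  assume L: ?L
  show ?R
  proof (intro ballI allI)
    fix V W X p
    assume VWX: "V \<in> vertical_fields AM AN F" "W \<in> vertical_fields AM AN F" "X \<in> horizontal_fields AM gM AN F"
    have "sff X V p = 0" "sff V W p = 0"
      using L VWX by (auto simp: totally_geodesic_map_def vertical_fields_def horizontal_fields_def)
    then show "nabM p (X p) V \<in> Ver p \<and> nabM p (V p) W \<in> Ver p"
      using VWX by (simp add: sff_vertical dF_Ver)
  qed
next
  assume R: ?R
  show ?L
    unfolding totally_geodesic_map_def
  proof (intro ballI allI)
    fix U W p assume U: "U \<in> vector_fields AM" and W: "W \<in> vector_fields AM"
    have split: "(\<lambda>q. \<V> q (Z q)) \<in> vertical_fields AM AN F" "(\<lambda>q. \<H> q (Z q)) \<in> horizontal_fields AM gM AN F"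
      if "Z \<in> vector_fields AM" for Z
      using horiz_field[OF that] vert_field[OF that] vert_in horiz_in
      by (auto simp: vertical_fields_def horizontal_fields_def)
    \<comment> \<open>The connection is linear in the direction, so \<open>U p\<close> may be split
      at the point. The two instances of the hypothesis below cover its horizontal and its vertical
      part.\<close>
    have v0: "sff U V p = 0" if U: "U \<in> vector_fields AM" and V: "V \<in> vertical_fields AM AN F" for U V
    proof -
      have "V \<in> vector_fields AM" using V by (simp add: vertical_fields_def)
      then have "nabM p (\<V> p (U p) + \<H> p (U p)) V = nabM p (\<V> p (U p)) V + nabM p (\<H> p (U p)) V"
        by (rule linear_add[OF linear_nabM])
      then have "nabM p (U p) V = nabM p (\<V> p (U p)) V + nabM p (\<H> p (U p)) V"
        by (simp add: horiz_eq)
      then have "nabM p (U p) V \<in> Ver p"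
        using R[rule_format, OF V V split(2)[OF U], of p] R[rule_format, OF split(1)[OF U] V split(2)[OF U], of p]
          subspace_add[OF subspace_Ver] by simp
      then show ?thesis using V by (simp add: sff_vertical dF_Ver)
    qed
    have dec: "sff U W p = sff U (\<lambda>q. \<H> q (W q)) p" if "W \<in> vector_fields AM" "U \<in> vector_fields AM" for U W
      using sff_add[OF vert_field[OF that(1)] horiz_field[OF that(1)], of U p] v0[OF that(2) split(1)[OF that(1)]]
      by (simp add: horiz_eq)
    \<comment> \<open>Only the second argument can be stripped of its vertical part directly;
      symmetry brings \<open>U\<close> into that position, and a horizontal pair remains.\<close>
    have "sff U W p = sff U (\<lambda>q. \<H> q (W q)) p" by (rule dec[OF W U])
    also have "\<dots> = sff (\<lambda>q. \<H> q (W q)) U p" by (rule sff_symmetric[OF U horiz_field[OF W]])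
    also have "\<dots> = sff (\<lambda>q. \<H> q (W q)) (\<lambda>q. \<H> q (U q)) p" by (rule dec[OF U horiz_field[OF W]])
    also have "\<dots> = 0" by (rule sff_horizontal[OF split(2)[OF W] split(2)[OF U]])
    finally show "sff U W p = 0" .
  qed
qed

section \<open>The tensor conditions for a parallel complex structure\<close>

text \<open>With \<open>w\<close> the derivative of \<open>V\<close>, both conditions concern
  \<open>R w\<close>: the first makes it horizontal, the second orthogonal to the complement of
  \<open>R p\<close> applied to the vertical space. Together they put it into that image, and
  \<open>R\<close> can be cancelled.\<close>

lemma tensor_conditions_iff:
  assumes lin: "\<And>p. linear (R p)" and R2: "\<And>p v. R p (R p v) = - v"
    and parallel: "\<And>p u X. X \<in> vector_fields AM \<Longrightarrow> nabM p u (\<lambda>q. R q (X q)) = R p (nabM p u X)"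
    and anti: "\<And>p v. v \<in> Ver p \<Longrightarrow> R p v \<in> Hor p"
  assumes V: "V \<in> vertical_fields AM AN F"
  shows "\<V> p (nabM p u (\<lambda>q. \<H> q (R q (V q)))) = 0 \<and>
      Q_proj AM gM AN F R p (\<H> p (nabM p u (\<lambda>q. R q (V q)))) = 0 \<longleftrightarrow> nabM p u V \<in> Ver p"
proof -
  have VV: "V \<in> vector_fields AM" "\<And>q. V q \<in> Ver q" using V by (auto simp: vertical_fields_def)
  have H: "(\<lambda>q. \<H> q (R q (V q))) = (\<lambda>q. R q (V q))"
    using horiz_Hor[OF anti[OF VV(2)]] by blast
  let ?w = "nabM p u V"
  let ?mu = "mu_space AM gM AN F R p"
  have mu: "subspace ?mu"
    unfolding mu_space_def subspace_def
    using subspace_0[OF subspace_Hor] subspace_add[OF subspace_Hor] subspace_scale[OF subspace_Hor]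
    by (auto simp: gM.left_simps)
  have RV: "subspace (R p ` Ver p)" by (rule linear_subspace_image[OF lin subspace_Ver])
  show ?thesis unfolding H parallel[OF VV(1)]
  proof
    assume L: "\<V> p (R p ?w) = 0 \<and> Q_proj AM gM AN F R p (\<H> p (R p ?w)) = 0"
    then have h: "\<H> p (R p ?w) = R p ?w" by (simp add: horiz_eq)
    with L have orth: "gM p (R p ?w) s = 0" if "s \<in> ?mu" for s
      using gM.orth_proj_orth[where p = p and u = "R p ?w", OF mu that] by (simp add: Q_proj_def)
    \<comment> \<open>The component of \<open>R w\<close> in the image of the vertical space. The
      remainder \<open>R w - k\<close> lies in \<open>?mu\<close>, so it is orthogonal to both
      \<open>R w\<close> and \<open>k\<close>, and hence to itself.\<close>
    define k where "k = orth_proj (gM p) (R p ` Ver p) (R p ?w)"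
    have k: "k \<in> R p ` Ver p" and ko: "\<And>s. s \<in> R p ` Ver p \<Longrightarrow> gM p (R p ?w - k) s = 0"
      unfolding k_def using gM.orth_proj_in[OF RV] gM.orth_proj_orth[OF RV] by auto
    have "R p ?w - k \<in> Hor p"
      using k anti h horiz_in by (intro subspace_diff[OF subspace_Hor]) (metis, auto)
    then have "R p ?w - k \<in> ?mu" using ko by (simp add: mu_space_def)
    then have "gM p (R p ?w) (R p ?w - k) = 0" by (rule orth)
    moreover have "gM p k (R p ?w - k) = 0" using ko[OF k] gM.sym by metis
    ultimately have "gM p (R p ?w - k) (R p ?w - k) = 0" by (simp add: gM.left_simps)
    then have "R p ?w = k" by (simp add: gM.eq_0_iff)
    then obtain v where v: "v \<in> Ver p" "R p ?w = R p v" using k by auto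
    \<comment> \<open>\<open>R p\<close> is injective because its square is minus the
      identity.\<close>
    then have "?w = v" using R2 by (metis neg_equal_iff_equal)
    then show "?w \<in> Ver p" using v by simp
  next
    assume w: "?w \<in> Ver p"
    have "orth_proj (gM p) ?mu (R p ?w) = 0"
    proof (rule gM.orth_proj_eqI[OF mu subspace_0[OF mu]])
      fix s assume "s \<in> ?mu"
      then have "gM p s (R p ?w) = 0" using w by (simp add: mu_space_def)
      then show "gM p (R p ?w - 0) s = 0" using gM.sym by (metis diff_zero)
    qed
    then show "\<V> p (R p ?w) = 0 \<and> Q_proj AM gM AN F R p (\<H> p (R p ?w)) = 0"
      using anti[OF w] by (simp add: vert_Hor horiz_Hor Q_proj_def)
  qed
qed

lemma totally_geodesic_iff_tensor_conditions:
  assumes lin: "\<And>p. linear (R p)" and R2: "\<And>p v. R p (R p v) = - v"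
    and parallel: "\<And>p u X. X \<in> vector_fields AM \<Longrightarrow> nabM p u (\<lambda>q. R q (X q)) = R p (nabM p u X)"
    and anti: "\<And>p v. v \<in> Ver p \<Longrightarrow> R p v \<in> Hor p"
  shows "totally_geodesic_map AM AN F nabM nabF \<longleftrightarrow>
    (\<forall>V\<in>vertical_fields AM AN F. \<forall>W\<in>vertical_fields AM AN F. \<forall>X\<in>horizontal_fields AM gM AN F. \<forall>p.
        oneill_A AM gM AN F nabM X (\<lambda>q. R q (V q)) p = 0
      \<and> Q_proj AM gM AN F R p (\<H> p (nabM p (X p) (\<lambda>q. R q (V q)))) = 0
      \<and> oneill_T AM gM AN F nabM V (\<lambda>q. R q (W q)) p = 0
      \<and> Q_proj AM gM AN F R p (\<H> p (nabM p (V p) (\<lambda>q. R q (W q)))) = 0)"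
  unfolding totally_geodesic_iff
proof (intro ball_cong refl all_cong1)
  fix V W X p
  assume V: "V \<in> vertical_fields AM AN F" and W: "W \<in> vertical_fields AM AN F" and X: "X \<in> horizontal_fields AM gM AN F"
  have Vp: "\<V> p (V p) = V p" and Xp: "\<H> p (X p) = X p"
    using V X by (auto simp: vertical_fields_def horizontal_fields_def vert_Ver horiz_Hor)
  \<comment> \<open>\<open>R Z\<close> is horizontal for vertical \<open>Z\<close>, so the summand
    of each O'Neill tensor that differentiates its vertical part is zero, and one vertical component
    remains.\<close>
  have v0: "(\<lambda>q. \<V> q (R q (Z q))) = (\<lambda>_. 0)" if "Z \<in> vertical_fields AM AN F" for Z
    using that by (auto simp: vertical_fields_def vert_Hor anti)
  have h0: "\<H> p 0 = 0" by (rule horiz_Hor[OF subspace_0[OF subspace_Hor]])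
  have 1: "oneill_A AM gM AN F nabM X (\<lambda>q. R q (V q)) p = \<V> p (nabM p (X p) (\<lambda>q. \<H> q (R q (V q))))"
    by (simp add: oneill_A_def Xp v0[OF V] nabM_0 h0)
  have 2: "oneill_T AM gM AN F nabM V (\<lambda>q. R q (W q)) p = \<V> p (nabM p (V p) (\<lambda>q. \<H> q (R q (W q))))"
    by (simp add: oneill_T_def Vp v0[OF W] nabM_0 h0)
  have iff: "\<V> p (nabM p u (\<lambda>q. \<H> q (R q (Z q)))) = 0 \<and>
      Q_proj AM gM AN F R p (\<H> p (nabM p u (\<lambda>q. R q (Z q)))) = 0 \<longleftrightarrow> nabM p u Z \<in> Ver p"
    if "Z \<in> vertical_fields AM AN F" for u Z
    by (rule tensor_conditions_iff[OF lin R2 parallel anti that])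
  show "nabM p (X p) V \<in> Ver p \<and> nabM p (V p) W \<in> Ver p \<longleftrightarrow>
        oneill_A AM gM AN F nabM X (\<lambda>q. R q (V q)) p = 0
      \<and> Q_proj AM gM AN F R p (\<H> p (nabM p (X p) (\<lambda>q. R q (V q)))) = 0
      \<and> oneill_T AM gM AN F nabM V (\<lambda>q. R q (W q)) p = 0
      \<and> Q_proj AM gM AN F R p (\<H> p (nabM p (V p) (\<lambda>q. R q (W q)))) = 0"
    unfolding 1 2 using iff[OF V, of "X p"] iff[OF W, of "V p"] by blast
qed

end

theorem theorem3p15:
  fixes AM :: "('a::{t2_space, second_countable_topology}, 'e::euclidean_space) chart set"
    and AN :: "('b::{t2_space, second_countable_topology}, 'f::euclidean_space) chart set"
    and I J K :: "'a \<Rightarrow> 'e \<Rightarrow> 'e"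
    and gM :: "'a \<Rightarrow> 'e \<Rightarrow> 'e \<Rightarrow> real" and gN :: "'b \<Rightarrow> 'f \<Rightarrow> 'f \<Rightarrow> real"
    and nabM :: "'a \<Rightarrow> 'e \<Rightarrow> ('a \<Rightarrow> 'e) \<Rightarrow> 'e" and nabN :: "'b \<Rightarrow> 'f \<Rightarrow> ('b \<Rightarrow> 'f) \<Rightarrow> 'f"
    and F :: "'a \<Rightarrow> 'b" and nabF :: "'a \<Rightarrow> 'e \<Rightarrow> ('a \<Rightarrow> 'f) \<Rightarrow> 'f"
  assumes "hyperkaehler AM I J K gM nabM"
    and "riemannian_manifold AN gN" and "levi_civita AN gN nabN"
    and "h_anti_invariant_submersion AM I J K gM AN gN F"
    and "pullback_connection AM AN F nabN nabF"
  shows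
    "(totally_geodesic_map AM AN F nabM nabF \<longleftrightarrow>
        (\<forall>V\<in>vertical_fields AM AN F. \<forall>W\<in>vertical_fields AM AN F. \<forall>X\<in>horizontal_fields AM gM AN F. \<forall>p.
            oneill_A AM gM AN F nabM X (\<lambda>q. I q (V q)) p = 0
          \<and> Q_proj AM gM AN F I p (horiz AM gM AN F p (nabM p (X p) (\<lambda>q. I q (V q)))) = 0
          \<and> oneill_T AM gM AN F nabM V (\<lambda>q. I q (W q)) p = 0
          \<and> Q_proj AM gM AN F I p (horiz AM gM AN F p (nabM p (V p) (\<lambda>q. I q (W q)))) = 0))
   \<and> (totally_geodesic_map AM AN F nabM nabF \<longleftrightarrow>
        (\<forall>V\<in>vertical_fields AM AN F. \<forall>W\<in>vertical_fields AM AN F. \<forall>X\<in>horizontal_fields AM gM AN F. \<forall>p.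
            oneill_A AM gM AN F nabM X (\<lambda>q. J q (V q)) p = 0
          \<and> Q_proj AM gM AN F J p (horiz AM gM AN F p (nabM p (X p) (\<lambda>q. J q (V q)))) = 0
          \<and> oneill_T AM gM AN F nabM V (\<lambda>q. J q (W q)) p = 0
          \<and> Q_proj AM gM AN F J p (horiz AM gM AN F p (nabM p (V p) (\<lambda>q. J q (W q)))) = 0))
   \<and> (totally_geodesic_map AM AN F nabM nabF \<longleftrightarrow>
        (\<forall>V\<in>vertical_fields AM AN F. \<forall>W\<in>vertical_fields AM AN F. \<forall>X\<in>horizontal_fields AM gM AN F. \<forall>p.
            oneill_A AM gM AN F nabM X (\<lambda>q. K q (V q)) p = 0
          \<and> Q_proj AM gM AN F K p (horiz AM gM AN F p (nabM p (X p) (\<lambda>q. K q (V q)))) = 0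
          \<and> oneill_T AM gM AN F nabM V (\<lambda>q. K q (W q)) p = 0
          \<and> Q_proj AM gM AN F K p (horiz AM gM AN F p (nabM p (V p) (\<lambda>q. K q (W q)))) = 0))"
proof -
  note hk = assms(1)[unfolded hyperkaehler_def]
  have sub: "riemannian_submersion AM gM AN gN F"
    using assms(4) by (simp add: h_anti_invariant_submersion_def)
  interpret submersion AM AN gM gN nabM nabN F nabF
    using hk assms(2,3,5) sub by (simp add: submersion_def)
  have endo: "\<forall>R\<in>{I, J, K}. endomorphism_field AM R" and sq: "\<forall>R\<in>{I, J, K}. \<forall>p v. R p (R p v) = - v"
    and par: "\<forall>R\<in>{I, J, K}. \<forall>p u. \<forall>X\<in>vector_fields AM. nabM p u (\<lambda>q. R q (X q)) = R p (nabM p u X)"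
    by (insert hk, elim conjE, assumption)+
  have anti: "\<forall>R\<in>{I, J, K}. \<forall>p. R p ` Ver p \<subseteq> Hor p"
    using assms(4) unfolding h_anti_invariant_submersion_def by (rule conjunct2)
  \<comment> \<open>Total geodesy does not mention \<open>R\<close>, so it serves as the common link
    between the three sets of conditions.\<close>
  have iff: "totally_geodesic_map AM AN F nabM nabF \<longleftrightarrow>
      (\<forall>V\<in>vertical_fields AM AN F. \<forall>W\<in>vertical_fields AM AN F. \<forall>X\<in>horizontal_fields AM gM AN F. \<forall>p.
          oneill_A AM gM AN F nabM X (\<lambda>q. R q (V q)) p = 0
        \<and> Q_proj AM gM AN F R p (\<H> p (nabM p (X p) (\<lambda>q. R q (V q)))) = 0
        \<and> oneill_T AM gM AN F nabM V (\<lambda>q. R q (W q)) p = 0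
        \<and> Q_proj AM gM AN F R p (\<H> p (nabM p (V p) (\<lambda>q. R q (W q)))) = 0)"
    if R: "R \<in> {I, J, K}" for R
  proof (rule totally_geodesic_iff_tensor_conditions)
    show "linear (R p)" for p using bspec[OF endo R] by (simp add: endomorphism_field_def)
    show "R p (R p v) = - v" for p v using bspec[OF sq R] by blast
    show "nabM p u (\<lambda>q. R q (X q)) = R p (nabM p u X)" if "X \<in> vector_fields AM" for p u X
      using bspec[OF par R] that by blast
    show "R p v \<in> Hor p" if "v \<in> Ver p" for p v using bspec[OF anti R] that by blast
  qed
  show ?thesis by (intro conjI iff) simp_all
qed

end
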